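(* Let $\bar\nu_0=n-\bar\nu_1-\cdots-\bar\nu_p$. Problem 3B (stated in the context) is solvable if and only if $$\dim\Big(\mathcal V^\star_g+\sum_{(i,j)\in P}\mathcal R_i(\lambda_{i,j})\Big)\ge\operatorname{card}P+\bar\nu_0$$ for all $P$ in the power set $2^I$, where $I=\{(1,1),\ldots,(1,\bar\nu_1),\ldots,(p,1),\ldots,(p,\bar\nu_p)\}$.
   Context: System: $\Sigma=(A,B,C,D)$ is $\mathcal D x=Ax+Bu$, $y=Cx+Du$, $x(t)\in\mathbb R^n$, $u(t)\in\mathbb R^m$, $y(t)\in\mathbb R^p$, real matrices; $\mathcal D x=\dot x$ (continuous time) or $x(t+1)$ (discrete time). $\mathbb C_g$ is the open left half-plane (continuous) or open unit disc (discrete), $\mathbb R_g=\mathbb C_g\cap\mathbb R$. Invariant zeros of $\Sigma$ are those $\lambda\in\mathbb C$ at which the rank of $\begin{bmatrix}A-\lambda I&B\\C&D\end{bmatrix}$ is below its normal rank; minimum-phase zeros are those in $\mathbb C_g$. Standing assumptions: $\Sigma$ is right invertible (that matrix pencil has full row rank for all but finitely many $\lambda$), stabilizable, with no invariant zero at $0$ (continuous) or $1$ (discrete); algebraic and geometric multiplicities of each minimum-phase invariant zero coincide; no Jordan chains are allowed in the closed loop ($A+BF$ diagonalizable); in this part all closed-loop eigenvalues considered and all minimum-phase invariant zeros are real. Control: $u=Fx+Gr$, $F$ real with $\sigma(A+BF)\subset\mathbb C_g$, $G$ a right inverse of the closed-loop static gain. For constant $r$, $\epsilon=y-r$ satisfies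 $\mathcal D\xi=(A+BF)\xi$, $\epsilon=(C+DF)\xi$. State-to-output decoupling (with $\nu_i$ modes in output $i$): for any initial condition, $\epsilon_i(t)=\sum_{j=1}^{\nu_i}\beta_{i,j}e^{\mu_{i,j}t}$ (resp. $\sum_j\beta_{i,j}\mu_{i,j}^t$), $i=1,\ldots,p$, where the $\mu_{i,j}$ are the observable closed-loop eigenvalues and the coefficients $\beta_{i,j}$ can be made arbitrary by choice of $\xi(0)$. That is, $A+BF$ has a basis of eigenvectors $v_{0,1},\ldots,v_{0,\nu_0},v_{1,1},\ldots,v_{p,\nu_p}$ with eigenvalues $\mu_{i,j}$ such that $(C+DF)v_{0,j}=0$ and $(C+DF)v_{i,j}$ is a nonzero multiple of the $i$-th canonical vector $e_i\in\mathbb R^p$ for $i\ge1$; the $\mu_{i,j}$ ($1\le j\le\nu_i$) are the eigenvalues observable from $\epsilon_i$ and the $\mu_{0,j}$ the unobservable ones (all counted with multiplicity). Problem 3B: given nonnegative integers $\bar\nu_1,\ldots,\bar\nu_p$ with $\bar\nu_0=n-\sum_i\bar\nu_i\ge0$, and assigned $\lambda_{i,j}\in\mathbb R_g$ ($i=1,\ldots,p$, $j=1,\ldots,\bar\nu_i$), allowed to be minimum-phase invariant zeros, find $F,G$ such that: (1) $y(t)\to\bar r$ for every constant reference $r(t)=\bar r$; (2) state-to-output decoupling is achieved; (3) from each $\epsilon_i$ at most $\bar\nu_i$ eigenvalues are observable ($\nu_i\le\bar\nu_i$); and the closed-loop eigenvalues observable from $\epsilon_i$ form a subset (sub-multiset)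 of $\{\lambda_{i,j}\}_{j=1,\ldots,\bar\nu_i}$, while the unobservable ones are not assigned a priori. Solvable means such $F,G$ exist. Subspaces: $\mathcal R_i(\lambda)=\{v\in\mathbb R^n\mid\exists w\in\mathbb R^m:\ (A-\lambda I)v+Bw=0,\ C_{(i)}v+D_{(i)}w=0\}$ for real $\lambda$, where $C_{(i)},D_{(i)}$ are $C,D$ with the $i$-th row removed. $\mathcal V^\star_g$ is the largest stabilizability output-nulling subspace of $\Sigma$: the largest subspace $\mathcal V\subseteq\mathbb R^n$ for which there is a real $F$ with $(A+BF)\mathcal V\subseteq\mathcal V\subseteq\ker(C+DF)$ and $\sigma(A+BF|\mathcal V)\subset\mathbb C_g$. *)

theory Defs
  imports
    "HOL-Analysis.Analysis"
    "HOL-Computational_Algebra.Polynomial_Factorial"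
    "HOL-Computational_Algebra.Field_as_Ring"
    "HOL-Library.Multiset"
begin

datatype time_domain = Continuous | Discrete

fun stable_region :: "time_domain \<Rightarrow> complex set" where
  "stable_region Continuous = {z. Re z < 0}"
| "stable_region Discrete = {z. cmod z < 1}"

text \<open>The complex frequency of constant signals.\<close>

fun dc_point :: "time_domain \<Rightarrow> 'a::zero_neq_one" where
  "dc_point Continuous = 0"
| "dc_point Discrete = 1"

section \<open>Spectra of real matrices\<close>

definition complex_matrix :: "real^'a^'b \<Rightarrow> complex^'a^'b" where
  "complex_matrix M = (\<chi> i j. complex_of_real (M $ i $ j))"

definition complexification :: "(real^'n) set \<Rightarrow> (complex^'n) set" where
  "complexification V = {z. (\<chi> i. Re (z $ i)) \<in> V \<and> (\<chi> i. Im (z $ i)) \<in> V}"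

text \<open>Spectrum of the restriction of a real matrix to an invariant real subspace \<open>V\<close>.\<close>

definition spectrum_on :: "real^'n^'n \<Rightarrow> (real^'n) set \<Rightarrow> complex set" where
  "spectrum_on M V =
     {s. \<exists>z \<in> complexification V. z \<noteq> 0 \<and> complex_matrix M *v z = s *s z}"

definition matrix_spectrum :: "real^'n^'n \<Rightarrow> complex set" where
  "matrix_spectrum M = {s. \<exists>z. z \<noteq> 0 \<and> complex_matrix M *v z = s *s z}"

definition stabilizable :: "time_domain \<Rightarrow> real^'n^'n \<Rightarrow> real^'m^'n \<Rightarrow> bool" where
  "stabilizable td A B \<longleftrightarrow> (\<exists>F :: real^'n^'m. matrix_spectrum (A + B ** F) \<subseteq> stable_region td)"

section \<open>System pencil and invariant zeros\<close>

definition system_pencil ::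
  "real^'n^'n \<Rightarrow> real^'m^'n \<Rightarrow> real^'n^'p \<Rightarrow> real^'m^'p \<Rightarrow> complex poly^('n + 'm)^('n + 'p)" where
  "system_pencil A B C D = (\<chi> r c. case (r, c) of
       (Inl i, Inl j) \<Rightarrow> [:complex_of_real (A $ i $ j), if i = j then - 1 else 0:]
     | (Inl i, Inr k) \<Rightarrow> [:complex_of_real (B $ i $ k):]
     | (Inr l, Inl j) \<Rightarrow> [:complex_of_real (C $ l $ j):]
     | (Inr l, Inr k) \<Rightarrow> [:complex_of_real (D $ l $ k):])"

definition system_matrix ::
  "real^'n^'n \<Rightarrow> real^'m^'n \<Rightarrow> real^'n^'p \<Rightarrow> real^'m^'p \<Rightarrow> complex \<Rightarrow> complex^('n + 'm)^('n + 'p)" where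
  "system_matrix A B C D s = (\<chi> r c. poly (system_pencil A B C D $ r $ c) s)"

definition normal_rank ::
  "real^'n^'n \<Rightarrow> real^'m^'n \<Rightarrow> real^'n^'p \<Rightarrow> real^'m^'p \<Rightarrow> nat" where
  "normal_rank A B C D = Max (range (\<lambda>s. rank (system_matrix A B C D s)))"

definition right_invertible ::
  "real^'n^'n \<Rightarrow> real^'m^'n \<Rightarrow> real^'n^'p \<Rightarrow> real^'m^'p \<Rightarrow> bool" where
  "right_invertible A B C D \<longleftrightarrow>
     finite {s. rank (system_matrix A B C D s) \<noteq> CARD('n) + CARD('p)}"

definition invariant_zeros ::
  "real^'n^'n \<Rightarrow> real^'m^'n \<Rightarrow> real^'n^'p \<Rightarrow> real^'m^'p \<Rightarrow> complex set" where
  "invariant_zeros A B C D = {s. rank (system_matrix A B C D s) < normal_rank A B C D}"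

definition minimum_phase_zeros ::
  "time_domain \<Rightarrow> real^'n^'n \<Rightarrow> real^'m^'n \<Rightarrow> real^'n^'p \<Rightarrow> real^'m^'p \<Rightarrow> complex set" where
  "minimum_phase_zeros td A B C D = invariant_zeros A B C D \<inter> stable_region td"

text \<open>
  The zero polynomial is the product of the invariant factors of the pencil, that is, the
  greatest common divisor of its minors of maximal order. For a right invertible system these
  are the minors using every row; \<open>f\<close> lists the selected columns (a repeated column merely
  contributes a zero determinant).
\<close>

definition zero_polynomial ::
  "real^'n^'n \<Rightarrow> real^'m^'n \<Rightarrow> real^'n^'p \<Rightarrow> real^'m^'p \<Rightarrow> complex poly" where
  "zero_polynomial A B C D =
     Gcd (range (\<lambda>f :: 'n + 'p \<Rightarrow> 'n + 'm. det (\<chi> r c. system_pencil A B C D $ r $ f c)))"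

definition algebraic_multiplicity ::
  "real^'n^'n \<Rightarrow> real^'m^'n \<Rightarrow> real^'n^'p \<Rightarrow> real^'m^'p \<Rightarrow> complex \<Rightarrow> nat" where
  "algebraic_multiplicity A B C D s = order s (zero_polynomial A B C D)"

definition geometric_multiplicity ::
  "real^'n^'n \<Rightarrow> real^'m^'n \<Rightarrow> real^'n^'p \<Rightarrow> real^'m^'p \<Rightarrow> complex \<Rightarrow> nat" where
  "geometric_multiplicity A B C D s =
     normal_rank A B C D - rank (system_matrix A B C D s)"

section \<open>Geometric subspaces\<close>

definition stabilizability_output_nulling ::
  "time_domain \<Rightarrow> real^'n^'n \<Rightarrow> real^'m^'n \<Rightarrow> real^'n^'p \<Rightarrow> real^'m^'p \<Rightarrow> (real^'n) set \<Rightarrow> bool" where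
  "stabilizability_output_nulling td A B C D V \<longleftrightarrow>
     subspace V \<and>
     (\<exists>F :: real^'n^'m.
        (\<forall>v\<in>V. (A + B ** F) *v v \<in> V \<and> (C + D ** F) *v v = 0) \<and>
        spectrum_on (A + B ** F) V \<subseteq> stable_region td)"

definition Vg_star ::
  "time_domain \<Rightarrow> real^'n^'n \<Rightarrow> real^'m^'n \<Rightarrow> real^'n^'p \<Rightarrow> real^'m^'p \<Rightarrow> (real^'n) set" where
  "Vg_star td A B C D = (GREATEST V. stabilizability_output_nulling td A B C D V)"

definition R_sub ::
  "real^'n^'n \<Rightarrow> real^'m^'n \<Rightarrow> real^'n^'p \<Rightarrow> real^'m^'p \<Rightarrow> 'p \<Rightarrow> real \<Rightarrow> (real^'n) set" where
  "R_sub A B C D i s =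
     {v. \<exists>w. (A - mat s) *v v + B *v w = 0 \<and> (\<forall>k. k \<noteq> i \<longrightarrow> (C *v v + D *v w) $ k = 0)}"

section \<open>The control problem\<close>

text \<open>Transfer matrix of the closed loop at the frequency of constant signals.\<close>

definition static_gain ::
  "time_domain \<Rightarrow> real^'n^'n \<Rightarrow> real^'m^'n \<Rightarrow> real^'n^'p \<Rightarrow> real^'m^'p \<Rightarrow> real^'n^'m \<Rightarrow> real^'m^'p" where
  "static_gain td A B C D F =
     (C + D ** F) ** matrix_inv (mat (dc_point td) - (A + B ** F)) ** B + D"

text \<open>Under \<open>u = F x + G r\<close>, the output tends to \<open>r\<close> for each constant \<open>r\<close> and each initial state.\<close>

fun tracks_constants ::
  "time_domain \<Rightarrow> real^'n^'n \<Rightarrow> real^'m^'n \<Rightarrow> real^'n^'p \<Rightarrow> real^'m^'p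
     \<Rightarrow> real^'n^'m \<Rightarrow> real^'p^'m \<Rightarrow> bool" where
  "tracks_constants Continuous A B C D F G \<longleftrightarrow>
     (\<forall>(r :: real^'p) (x :: real \<Rightarrow> real^'n).
        (\<forall>t\<ge>0. (x has_vector_derivative (A *v x t + B *v (F *v x t + G *v r))) (at t within {0..}))
        \<longrightarrow> ((\<lambda>t. C *v x t + D *v (F *v x t + G *v r)) \<longlongrightarrow> r) at_top)"
| "tracks_constants Discrete A B C D F G \<longleftrightarrow>
     (\<forall>(r :: real^'p) (x :: nat \<Rightarrow> real^'n).
        (\<forall>t. x (Suc t) = A *v x t + B *v (F *v x t + G *v r))
        \<longrightarrow> (\<lambda>t. C *v x t + D *v (F *v x t + G *v r)) \<longlonglongrightarrow> r)"

text \<open>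
  Modal form of state-to-output decoupling. The family \<open>v k j\<close>, \<open>1 \<le> j \<le> \<nu> k\<close>, is a basis of
  real eigenvectors of \<open>A + B F\<close> with eigenvalues \<open>\<mu> k j\<close>; the index \<open>k = Some i\<close> collects the
  modes seen in output \<open>i\<close> only, and \<open>k = None\<close> (index 0 on paper) the unobservable ones.
\<close>

definition state_to_output_decoupling ::
  "real^'n^'n \<Rightarrow> real^'m^'n \<Rightarrow> real^'n^'p \<Rightarrow> real^'m^'p \<Rightarrow> real^'n^'m
     \<Rightarrow> ('p option \<Rightarrow> nat) \<Rightarrow> ('p option \<Rightarrow> nat \<Rightarrow> real) \<Rightarrow> ('p option \<Rightarrow> nat \<Rightarrow> real^'n) \<Rightarrow> bool" where
  "state_to_output_decoupling A B C D F \<nu> \<mu> v \<longleftrightarrow>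
     (let J = (SIGMA k:UNIV. {1..\<nu> k}) in
        inj_on (\<lambda>(k, j). v k j) J \<and>
        independent ((\<lambda>(k, j). v k j) ` J) \<and>
        span ((\<lambda>(k, j). v k j) ` J) = UNIV \<and>
        (\<forall>(k, j)\<in>J. (A + B ** F) *v v k j = \<mu> k j *\<^sub>R v k j) \<and>
        (\<forall>j\<in>{1..\<nu> None}. (C + D ** F) *v v None j = 0) \<and>
        (\<forall>i. \<forall>j\<in>{1..\<nu> (Some i)}.
           \<exists>\<beta>. \<beta> \<noteq> 0 \<and> (C + D ** F) *v v (Some i) j = \<beta> *\<^sub>R axis i 1))"

definition problem_3B_solvable ::
  "time_domain \<Rightarrow> real^'n^'n \<Rightarrow> real^'m^'n \<Rightarrow> real^'n^'p \<Rightarrow> real^'m^'p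
     \<Rightarrow> ('p \<Rightarrow> nat) \<Rightarrow> ('p \<Rightarrow> nat \<Rightarrow> real) \<Rightarrow> bool" where
  "problem_3B_solvable td A B C D \<nu>bar ev \<longleftrightarrow>
     (\<exists>(F :: real^'n^'m) (G :: real^'p^'m).
        matrix_spectrum (A + B ** F) \<subseteq> stable_region td \<and>
        static_gain td A B C D F ** G = mat 1 \<and>
        tracks_constants td A B C D F G \<and>
        (\<exists>\<nu> \<mu> v.
           state_to_output_decoupling A B C D F \<nu> \<mu> v \<and>
           (\<forall>i. \<nu> (Some i) \<le> \<nu>bar i \<and>
                image_mset (\<mu> (Some i)) (mset_set {1..\<nu> (Some i)})
                  \<subseteq># image_mset (ev i) (mset_set {1..\<nu>bar i}))))"

end

theory Submission
  imports Defs "HOL-Computational_Algebra.Fundamental_Theorem_Algebra"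
begin

text \<open>
  The key fact is that \<open>Vg_star\<close> is spanned by the directions \<open>v\<close> with
  \<open>A v + B w = s v\<close>, \<open>C v + D w = 0\<close> for real stable \<open>s\<close>. Near each stable \<open>z\<close> semisimplicity
  of the zeros bounds the orders of the minors of the pencil, so the pencil has a polynomial
  right inverse up to a factor \<open>(s - z) d(s)\<close> with \<open>d(z) \<noteq> 0\<close>; this turns chains of generalised
  eigenvectors inside an output-nulling subspace into polynomial kernel vectors of the pencil.

  If the problem is solvable, the unobservable eigenvectors lie in \<open>Vg_star\<close> and the observable
  ones in the \<open>R_sub i (ev i j)\<close>, and counting gives the dimension bounds. Conversely, a deficiency
  version of Rado's theorem selects vectors of the \<open>R_sub i (ev i j)\<close> that complete a basis of
  \<open>Vg_star\<close>; the feedback is defined on this basis. A selected vector with vanishing output would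
  lie in \<open>Vg_star\<close>, so every selected mode is seen in its output.
\<close>

section \<open>Minors of polynomial matrices\<close>

text \<open>The obstacle is that \<open>Vg_star\<close> is defined by feedbacks whose restriction
  may have Jordan blocks and nonreal eigenvalues, while a solution needs real eigenvectors.
  Generalised and nonreal eigenvectors have to be traded for real kernel directions of the pencil at
  other frequencies. Kernel vectors come in polynomial families, and a scalar polynomial that
  vanishes at infinitely many real stable points also vanishes at the repeated or nonreal eigenvalue
  of interest. Hence the argument tests against functionals that vanish on
  \<open>stable_zero_span\<close> instead of decomposing vectors explicitly. At a zero this requires
  that one factor \<open>s - z\<close> suffices: a corank \<open>g\<close> at \<open>z\<close>
  always forces order at least \<open>g\<close> on every maximal minor, and equality of the
  multiplicities provides a minor of order exactly \<open>g\<close>.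

  The dimension condition involves \<open>\<nu>bar0\<close>, not the dimension of
  \<open>Vg_star\<close>. If that dimension exceeds \<open>\<nu>bar0\<close>, the surplus takes the
  place of assigned modes; this is why fewer than \<open>\<nu>bar i\<close> modes may be observable
  and why a version of Rado's theorem with deficiency is needed.\<close>

definition eval_matrix :: "complex poly^'a^'b \<Rightarrow> complex \<Rightarrow> complex^'a^'b" where
  "eval_matrix M s = (\<chi> i j. poly (M $ i $ j) s)"

definition eval_vector :: "complex poly^'a \<Rightarrow> complex \<Rightarrow> complex^'a" where
  "eval_vector q s = (\<chi> i. poly (q $ i) s)"

text \<open>Columns may be repeated, which matches the family of minors in
  \<open>zero_polynomial\<close>.\<close>

definition select_columns :: "('b \<Rightarrow> 'a) \<Rightarrow> 'e^'a^'c \<Rightarrow> 'e^'b^'c" where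
  "select_columns f M = (\<chi> i j. M $ i $ f j)"

lemma poly_det: "poly (det M) s = det (eval_matrix M s)"
  unfolding det_def eval_matrix_def
  by (simp add: poly_sum poly_prod of_int_poly)

lemma det_constant_polys:
  fixes Q :: "complex^'a^'a"
  shows "det (\<chi> i j. [:Q $ i $ j:]) = [:det Q:]"
proof -
  have "poly (det (\<chi> i j. [:Q $ i $ j:])) s = poly [:det Q:] s" for s
    by (simp add: poly_det eval_matrix_def)
  then have "poly (det (\<chi> i j. [:Q $ i $ j:])) = poly [:det Q:]" by blast
  then show ?thesis by (simp only: poly_eq_poly_eq_iff)
qed

lemma independent_UNIV_bij:
  fixes R :: "(complex^'a) set"
  assumes "vec.independent R" "vec.span R = UNIV"
  obtains h :: "'a \<Rightarrow> complex^'a" where "bij_betw h UNIV R" "invertible (\<chi> k. h k)"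
proof -
  have fin: "finite R"
    using assms(1) vec.finiteI_independent by blast
  have "card R = CARD('a)"
    using assms by (metis vec.dim_UNIV vec.dim_span_eq_card_independent vec_dim_card)
  then obtain h :: "'a \<Rightarrow> complex^'a" where h: "bij_betw h UNIV R"
    using finite_same_card_bij[of "UNIV :: 'a set" R] fin by auto
  have "rows (\<chi> k. h k) = R"
    using h by (auto simp: rows_def row_def bij_betw_def vec_lambda_eta)
  then have "\<exists>Q. Q ** (\<chi> k. h k) = mat 1"
    using assms(2) by (simp add: matrix_left_invertible_span_rows_gen)
  then have "invertible (\<chi> k. h k)"
    by (simp add: invertible_left_inverse)
  with h show ?thesis by (rule that)
qed

text \<open>Extend a basis of the row space at \<open>z\<close> to a basis of the whole space and
  pass to coordinates in it. The columns belonging to the added vectors vanish at \<open>z\<close>,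
  and each contributes one factor to the determinant; the constant change of basis only multiplies
  it by a nonzero number.\<close>

lemma det_order_ge_corank:
  fixes M :: "complex poly^'a^'a"
  assumes "rank (eval_matrix M z) \<le> r"
  shows "[:-z, 1:] ^ (CARD('a) - r) dvd det M"
proof -
  let ?Mz = "eval_matrix M z"
  obtain R where R: "R \<subseteq> rows ?Mz" "vec.independent R" "rows ?Mz \<subseteq> vec.span R"
      "card R = rank ?Mz"
    using vec.basis_exists[of "rows ?Mz"] unfolding row_rank_def_gen by metis
  let ?E = "vec.extend_basis R"
  have E: "R \<subseteq> ?E" "vec.independent ?E" "vec.span ?E = UNIV"
    using R(2) vec.extend_basis_superset vec.independent_extend_basis vec.span_extend_basis
    by blast+
  obtain h :: "'a \<Rightarrow> complex^'a" where h: "bij_betw h UNIV ?E" and inv: "invertible (\<chi> k. h k)"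
    using independent_UNIV_bij[OF E(2,3)] .
  then obtain Q where Q: "(\<chi> k. h k) ** Q = mat 1" "Q ** (\<chi> k. h k) = mat 1"
    by (auto simp: invertible_def)
  have hQ: "(\<Sum>l\<in>UNIV. h k $ l * Q $ l $ j) = (if k = j then 1 else 0)" for k j
    using Q(1) by (simp add: vec_eq_iff matrix_matrix_mult_def mat_def)
  \<comment> \<open>The entries of \<open>v Q\<close> are the coordinates of \<open>v\<close> in the
    basis enumerated by \<open>h\<close>.\<close>
  have zero: "(\<Sum>l\<in>UNIV. v $ l * Q $ l $ j) = 0" if v: "v \<in> vec.span R" and j: "h j \<notin> R" for v j
    using v
  proof (induction rule: vec.span_induct_alt)
    case base
    show ?case by simp
  next
    case (step c x y)
    then obtain k where k: "x = h k"
      using h E(1) by (metis bij_betw_imp_surj_on imageE subsetD)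
    then have "k \<noteq> j" using step j by auto
    then show ?case
      using step hQ[of k j] k
      by (simp add: distrib_right sum.distrib mult.assoc flip: sum_distrib_left)
  qed
  define N :: "complex poly^'a^'a" where "N = M ** (\<chi> i j. [:Q $ i $ j:])"
  let ?J = "{j. h j \<notin> R}"
  have "\<exists>T. transpose N $ j = (if h j \<notin> R then [:-z, 1:] else 1) *s T" for j
  proof (cases "h j \<in> R")
    case True
    then show ?thesis by (intro exI[of _ "transpose N $ j"]) simp
  next
    case False
    have "[:-z, 1:] dvd N $ i $ j" for i
    proof -
      have "row i ?Mz \<in> vec.span R"
        using R(3) by (auto simp: rows_def)
      from zero[OF this False] have "poly (N $ i $ j) z = 0"
        by (simp add: N_def matrix_matrix_mult_def row_def eval_matrix_def poly_sum mult.commute)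
      then show ?thesis by (simp add: poly_eq_0_iff_dvd)
    qed
    then have "\<forall>i. \<exists>t. N $ i $ j = [:-z, 1:] * t" by (auto simp: dvd_def)
    then obtain t where "\<And>i. N $ i $ j = [:-z, 1:] * t i" by metis
    then have "transpose N $ j = [:-z, 1:] *s (\<chi> i. t i)"
      by (simp add: vec_eq_iff transpose_def)
    with False show ?thesis by auto
  qed
  then obtain T where T: "\<And>j. transpose N $ j = (if h j \<notin> R then [:-z, 1:] else 1) *s T j"
    by metis
  have "det N = det (transpose N)" by (simp add: det_transpose)
  also have "transpose N = (\<chi> j. (if h j \<notin> R then [:-z, 1:] else 1) *s T j)"
    by (simp add: vec_eq_iff flip: T)
  also have "det \<dots> = (\<Prod>j\<in>UNIV. if h j \<notin> R then [:-z, 1:] else 1) * det (\<chi> j. T j)"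
    by (rule det_rows_mul)
  also have "(\<Prod>j\<in>UNIV. if h j \<notin> R then [:-z, 1:] else 1) = [:-z, 1:] ^ card ?J"
    by (subst prod.If_cases) auto
  finally have "[:-z, 1:] ^ card ?J dvd det N" by simp
  moreover have "det N = det M * [:det Q:]"
    by (simp add: N_def det_mul det_constant_polys)
  moreover have "det Q \<noteq> 0"
    using Q by (metis invertible_det_nz invertible_def)
  ultimately have "[:-z, 1:] ^ card ?J dvd det M"
    by (simp add: dvd_smult_cancel mult.commute)
  moreover have "CARD('a) - r \<le> card ?J"
  proof -
    have "bij_betw h {j. h j \<in> R} R"
      using h E(1) by (auto simp: bij_betw_def inj_on_def)
    then have "card {j. h j \<in> R} = rank ?Mz"
      using R(4) bij_betw_same_card by fastforce
    moreover have "card {j. h j \<in> R} + card ?J = CARD('a)"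
      by (subst card_Un_disjoint[symmetric]) (auto intro: arg_cong[where f = card])
    ultimately show ?thesis using assms by linarith
  qed
  ultimately show ?thesis
    using power_le_dvd by blast
qed

text \<open>This is entry \<open>(k, l)\<close> of the adjugate. Column \<open>k\<close> is replaced
  by a unit vector, and nothing is deleted, so the size is unchanged and
  \<open>det_order_ge_corank\<close> applies with a rank larger by at most one.\<close>

definition cofactor_entry :: "'a::comm_ring_1^'n^'n \<Rightarrow> 'n \<Rightarrow> 'n \<Rightarrow> 'a" where
  "cofactor_entry M k l = det (\<chi> i j. if j = k then (if i = l then 1 else 0) else M $ i $ j)"

text \<open>Cramer's rule is available over a field only, so it is used at the points where
  \<open>det M\<close> does not vanish. Multiplying the difference of both sides by
  \<open>det M\<close> takes care of the other points, and the nonzero factor cancels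
  afterwards.\<close>

lemma cofactor_expansion:
  fixes M :: "complex poly^'a^'a"
  assumes "det M \<noteq> 0"
  shows "(\<Sum>k\<in>UNIV. M $ i $ k * cofactor_entry M k l) = (if i = l then det M else 0)"
proof -
  let ?d = "(\<Sum>k\<in>UNIV. M $ i $ k * cofactor_entry M k l) - (if i = l then det M else 0)"
  have "poly (?d * det M) s = 0" for s
  proof (cases "poly (det M) s = 0")
    case False
    let ?A = "eval_matrix M s"
    have d0: "det ?A \<noteq> 0" using False by (simp add: poly_det)
    let ?b = "axis l 1 :: complex^'a"
    have "?A *v (\<chi> k. det (\<chi> i j. if j = k then ?b $ i else ?A $ i $ j) / det ?A) = ?b"
      using cramer[OF d0] by blast
    then have "(\<Sum>k\<in>UNIV. ?A $ i $ k * (det (\<chi> i j. if j = k then ?b $ i else ?A $ i $ j) / det ?A))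
        = ?b $ i"
      by (simp add: matrix_vector_mult_def vec_eq_iff)
    then have *: "(\<Sum>k\<in>UNIV. ?A $ i $ k * det (\<chi> i j. if j = k then ?b $ i else ?A $ i $ j))
        = det ?A * ?b $ i"
      using d0 by (simp add: field_simps flip: sum_divide_distrib)
    have "poly (cofactor_entry M k l) s = det (\<chi> i j. if j = k then ?b $ i else ?A $ i $ j)" for k
      unfolding cofactor_entry_def poly_det eval_matrix_def
      by (intro arg_cong[where f = det]) (auto simp: vec_eq_iff axis_def)
    with * have "(\<Sum>k\<in>UNIV. poly (M $ i $ k) s * poly (cofactor_entry M k l) s)
        = poly (det M) s * ?b $ i"
      by (simp add: eval_matrix_def poly_det)
    then show ?thesis by (simp add: poly_sum axis_def)
  qed simp
  then have "?d * det M = 0" using poly_all_0_iff_0 by blast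
  with assms show ?thesis by simp
qed

text \<open>Erasing coordinate \<open>k\<close> is linear and cannot increase the rank of the rows;
  the new column then adds at most the direction of one unit vector to the row space.\<close>

lemma rank_replace_column:
  fixes A :: "complex^'a^'b"
  shows "rank (\<chi> i j. if j = k then b i else A $ i $ j) \<le> rank A + 1"
proof -
  let ?B = "(\<chi> i j. if j = k then b i else A $ i $ j)"
  define p :: "complex^'a \<Rightarrow> complex^'a" where "p v = (\<chi> j. if j = k then 0 else v $ j)" for v
  have lin: "Vector_Spaces.linear (*s) (*s) p"
    by unfold_locales (auto simp: p_def vec_eq_iff algebra_simps)
  have "row i ?B \<in> vec.span (insert (axis k 1) (p ` rows A))" for i
  proof -
    have eq: "row i ?B = p (row i A) + b i *s axis k 1"
      by (auto simp: vec_eq_iff row_def p_def axis_def)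
    have "p (row i A) \<in> p ` rows A" by (auto simp: rows_def)
    then show ?thesis
      unfolding eq by (intro vec.span_add vec.span_scale vec.span_base) auto
  qed
  then have "vec.dim (rows ?B) \<le> vec.dim (vec.span (insert (axis k 1) (p ` rows A)))"
    by (intro vec.dim_subset) (auto simp: rows_def)
  also have "\<dots> \<le> vec.dim (p ` rows A) + 1"
    unfolding vec.dim_span vec.dim_insert by simp
  also have "\<dots> \<le> vec.dim (rows A) + 1"
    using vec.dim_image_le[OF lin] by simp
  finally show ?thesis by (simp add: row_rank_def_gen)
qed

lemma rank_select_columns:
  fixes A :: "complex^'a^'b" and f :: "'c::finite \<Rightarrow> 'a"
  shows "rank (select_columns f A) \<le> rank A"
proof -
  define p :: "complex^'a \<Rightarrow> complex^'c" where "p v = (\<chi> j. v $ f j)" for v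
  have lin: "Vector_Spaces.linear (*s) (*s) p"
    by unfold_locales (auto simp: p_def vec_eq_iff algebra_simps)
  have "rows (select_columns f A) = p ` rows A"
    by (auto simp: rows_def row_def p_def select_columns_def)
  then show ?thesis
    using vec.dim_image_le[OF lin] by (simp add: row_rank_def_gen)
qed

lemma rank_le_rows:
  fixes A :: "complex^'a^'b"
  shows "rank A \<le> CARD('b)"
proof -
  have "rows A = range (\<lambda>i. row i A)" by (auto simp: rows_def)
  then have "card (rows A) \<le> CARD('b)" "finite (rows A)"
    by (simp_all add: card_image_le)
  then show ?thesis
    unfolding row_rank_def_gen using vec.dim_le_card'[of "rows A"] by simp
qed

text \<open>\<open>rows A\<close> is a set, so counting must first exclude repeated rows; only then
  does its independence yield independence of the indexed family of rows, and with it a right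
  inverse.\<close>

lemma full_row_rank_surj:
  fixes A :: "complex^'a^'b"
  assumes "rank A = CARD('b)"
  shows "vec.span (columns A) = UNIV" "surj ((*v) A)"
proof -
  have rng: "rows A = range (\<lambda>i. row i A)" by (auto simp: rows_def)
  have fin: "finite (rows A)" by (simp add: rng)
  have le: "card (rows A) \<le> CARD('b)" by (simp add: rng card_image_le)
  have dim: "vec.dim (rows A) = CARD('b)" using assms by (simp add: row_rank_def_gen)
  with le fin have card: "card (rows A) = CARD('b)"
    using vec.dim_le_card'[of "rows A"] by simp
  then have inj: "inj (\<lambda>i. row i A)"
    unfolding rng by (simp add: eq_card_imp_inj_on)
  have ind: "vec.independent (rows A)"
    using dim card fin vec.card_le_dim_spanning[of "rows A" "rows A"]
    by (simp add: vec.span_superset)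
  have "\<forall>i. c i = 0" if "(\<Sum>i\<in>UNIV. c i *s row i A) = 0" for c
  proof -
    have "(\<Sum>v\<in>rows A. c (inv (\<lambda>i. row i A) v) *s v) = (\<Sum>i\<in>UNIV. c i *s row i A)"
      unfolding rng by (subst sum.reindex[OF inj]) (simp add: inv_f_f[OF inj] o_def)
    then have "c (inv (\<lambda>i. row i A) (row i A)) = 0" for i
      using ind fin that rng vec.independentD[of "rows A" "rows A" "\<lambda>v. c (inv (\<lambda>i. row i A) v)"]
      by auto
    then show ?thesis by (simp add: inv_f_f[OF inj])
  qed
  then have ex: "\<exists>B. A ** B = mat 1"
    by (simp add: matrix_right_invertible_independent_rows)
  then show "vec.span (columns A) = UNIV"
    by (simp add: matrix_right_invertible_span_columns)
  show "surj ((*v) A)"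
    using ex by (metis matrix_vector_mul_assoc matrix_vector_mul_lid surjI)
qed

lemma full_row_rank_minor:
  fixes A :: "complex^'a^'b"
  assumes "rank A = CARD('b)"
  obtains f :: "'b \<Rightarrow> 'a" where "det (select_columns f A) \<noteq> 0"
proof -
  obtain R where R: "R \<subseteq> columns A" "vec.independent R" "columns A \<subseteq> vec.span R"
    using vec.basis_exists[of "columns A"] by metis
  then have "vec.span R = UNIV"
    using full_row_rank_surj(1)[OF assms] by (metis top.extremum_unique vec.span_mono vec.span_span)
  then obtain h :: "'b \<Rightarrow> complex^'b" where h: "bij_betw h UNIV R" and inv: "invertible (\<chi> k. h k)"
    using independent_UNIV_bij[OF R(2)] by metis
  have "\<forall>k. \<exists>j. h k = column j A"
    using h R(1) by (auto simp: bij_betw_def columns_def)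
  then obtain f where f: "\<And>k. h k = column (f k) A" by metis
  have "(\<chi> k. h k) = transpose (select_columns f A)"
    by (simp add: vec_eq_iff f column_def transpose_def select_columns_def)
  then have "det (select_columns f A) \<noteq> 0"
    using inv by (metis det_transpose invertible_det_nz)
  then show ?thesis by (rule that)
qed

text \<open>
  If \<open>g\<close> is the corank at \<open>z\<close>, the cofactors of a maximal minor of order \<open>g\<close> have order at least
  \<open>g - 1\<close>, so dividing Cramer's rule by \<open>(s - z)^(g - 1)\<close> leaves a single factor \<open>s - z\<close>.
\<close>

lemma semisimple_local_inverse:
  fixes P :: "complex poly^'a^'b"
  assumes g: "CARD('b) = rank (eval_matrix P z) + g"
    and f: "\<not> [:-z, 1:] ^ Suc g dvd det (select_columns f P)"
  obtains d where "poly d z \<noteq> 0"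
    "\<And>e :: complex^'b. \<exists>q :: complex poly^'a.
       (\<forall>s. eval_matrix P s *v eval_vector q s = ((s - z) * poly d s) *s e) \<and>
       (g = 0 \<longrightarrow> eval_vector q z = 0)"
proof -
  let ?X = "[:-z, 1:]"
  let ?M = "select_columns f P"
  have eval_M: "eval_matrix ?M s = select_columns f (eval_matrix P s)" for s
    by (simp add: eval_matrix_def select_columns_def)
  have rk: "rank (eval_matrix ?M z) \<le> rank (eval_matrix P z)"
    unfolding eval_M by (rule rank_select_columns)
  have "?X ^ g dvd det ?M"
    using det_order_ge_corank[OF rk] g by simp
  then obtain d where d: "det ?M = ?X ^ g * d" by (auto simp: dvd_def)
  have dz: "poly d z \<noteq> 0"
  proof
    assume "poly d z = 0"
    then have "?X dvd d" by (simp add: poly_eq_0_iff_dvd)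
    then have "?X ^ g * ?X dvd det ?M" unfolding d by (intro mult_dvd_mono dvd_refl)
    then have "?X ^ Suc g dvd det ?M" by (simp only: power_Suc2)
    with f show False by simp
  qed
  have nz: "det ?M \<noteq> 0" using f by auto
  have cof: "?X ^ (g - 1) dvd cofactor_entry ?M k l" for k l
  proof -
    have "eval_matrix (\<chi> i j. if j = k then (if i = l then 1 else 0) else ?M $ i $ j) z
      = (\<chi> i j. if j = k then (if i = l then 1 else 0) else eval_matrix ?M z $ i $ j)"
      by (auto simp: vec_eq_iff eval_matrix_def)
    then have "rank (eval_matrix (\<chi> i j. if j = k then (if i = l then 1 else 0) else ?M $ i $ j) z)
       \<le> rank (eval_matrix P z) + 1"
      using rank_replace_column[of k "\<lambda>i. if i = l then 1 else 0" "eval_matrix ?M z"] rk by simp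
    from det_order_ge_corank[OF this] show ?thesis
      using g by (simp add: cofactor_entry_def)
  qed
  obtain t' where t': "\<And>k l. cofactor_entry ?M k l = ?X ^ (g - 1) * t' k l"
    using cof unfolding dvd_def by metis
  \<comment> \<open>For \<open>g = 0\<close> the truncated exponent \<open>g - 1\<close> is 0 and
    Cramer's rule already gives the right-hand side \<open>d\<close>. The extra factor makes both
    cases uniform and makes the solution vanish at \<open>z\<close>.\<close>
  define t where "t k l = (if g = 0 then ?X else 1) * t' k l" for k l
  have main: "(\<Sum>k\<in>UNIV. ?M $ i $ k * t k l) = (if i = l then ?X * d else 0)" for i l
  proof -
    have "?X ^ g * (\<Sum>k\<in>UNIV. ?M $ i $ k * t k l)
        = ?X * (\<Sum>k\<in>UNIV. ?M $ i $ k * cofactor_entry ?M k l)"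
      unfolding sum_distrib_left t_def t' by (cases g) (auto intro!: sum.cong simp: algebra_simps)
    also have "\<dots> = ?X * (if i = l then ?X ^ g * d else 0)"
      unfolding cofactor_expansion[OF nz] d ..
    also have "\<dots> = ?X ^ g * (if i = l then ?X * d else 0)"
    proof (cases "i = l")
      case True
      show ?thesis unfolding if_P[OF True] by (rule mult.left_commute)
    next
      case False
      show ?thesis unfolding if_not_P[OF False] by (simp only: mult_zero_right)
    qed
    finally show ?thesis by (simp only: mult_cancel_left) simp
  qed
  have "\<exists>q :: complex poly^'a.
       (\<forall>s. eval_matrix P s *v eval_vector q s = ((s - z) * poly d s) *s e) \<and>
       (g = 0 \<longrightarrow> eval_vector q z = 0)" for e :: "complex^'b"
  proof (intro exI conjI allI impI)
    define qm where "qm k = (\<Sum>l\<in>UNIV. t k l * [:e $ l:])" for k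
    \<comment> \<open>The solution for the selected columns is spread over all columns. Summing over
      the fibres of \<open>f\<close> avoids any appeal to its injectivity.\<close>
    let ?q = "(\<chi> c. \<Sum>k | f k = c. qm k) :: complex poly^'a"
    show "eval_matrix P s *v eval_vector ?q s = ((s - z) * poly d s) *s e" for s
    proof -
      have "(\<Sum>c\<in>UNIV. P $ i $ c * ?q $ c) = ?X * d * [:e $ i:]" for i
      proof -
        have "(\<Sum>c\<in>UNIV. P $ i $ c * ?q $ c) = (\<Sum>c\<in>UNIV. \<Sum>k | f k = c. P $ i $ f k * qm k)"
          by (simp add: sum_distrib_left)
        also have "\<dots> = (\<Sum>k\<in>UNIV. P $ i $ f k * qm k)"
          using sum.group[of "UNIV :: 'b set" "UNIV :: 'a set" f "\<lambda>k. P $ i $ f k * qm k"] by simp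
        also have "\<dots> = (\<Sum>k\<in>UNIV. \<Sum>l\<in>UNIV. ?M $ i $ k * t k l * [:e $ l:])"
          by (simp add: qm_def sum_distrib_left select_columns_def mult.assoc del: mult_pCons_right)
        also have "\<dots> = (\<Sum>l\<in>UNIV. (\<Sum>k\<in>UNIV. ?M $ i $ k * t k l) * [:e $ l:])"
          by (subst sum.swap) (simp add: sum_distrib_right del: mult_pCons_right)
        also have "\<dots> = ?X * d * [:e $ i:]"
          unfolding main by (simp add: if_distrib[of "\<lambda>x. x * _"] cong: if_cong del: mult_pCons_right)
        finally show ?thesis .
      qed
      then have "poly (\<Sum>c\<in>UNIV. P $ i $ c * ?q $ c) s = poly (?X * d * [:e $ i:]) s" for i
        by simp
      then show ?thesis
        by (simp add: vec_eq_iff matrix_vector_mult_def eval_matrix_def eval_vector_def poly_sum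
            algebra_simps)
    qed
    show "eval_vector ?q z = 0" if "g = 0"
      using that by (simp add: vec_eq_iff eval_vector_def qm_def t_def poly_sum)
  qed
  with dz show ?thesis by (rule that)
qed

section \<open>Invariant subspaces of complex matrices\<close>

text \<open>A product of factors \<open>N - l\<close> with \<open>l\<close> in \<open>L\<close>
  annihilates the vector, and all intermediate vectors stay in \<open>Z\<close>. This is the part of
  the Jordan form that is needed, in a shape that permits induction from 0 outwards.\<close>

inductive eigen_chain :: "complex^'n^'n \<Rightarrow> complex set \<Rightarrow> (complex^'n) set \<Rightarrow> complex^'n \<Rightarrow> bool"
  for N L Z where
  zero: "eigen_chain N L Z 0"
| step: "z \<in> Z \<Longrightarrow> l \<in> L \<Longrightarrow> eigen_chain N L Z (N *v z - l *s z) \<Longrightarrow> eigen_chain N L Z z"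

text \<open>The vector \<open>p(N) z\<close>, written with iterates so that no matrix powers
  occur.\<close>

definition poly_apply :: "complex poly \<Rightarrow> complex^'n^'n \<Rightarrow> complex^'n \<Rightarrow> complex^'n" where
  "poly_apply p N z = (\<Sum>i\<le>degree p. coeff p i *s (((*v) N ^^ i) z))"

lemma poly_apply_eq:
  "degree p \<le> K \<Longrightarrow> poly_apply p N z = (\<Sum>i\<le>K. coeff p i *s (((*v) N ^^ i) z))"
  unfolding poly_apply_def
  by (rule sum.mono_neutral_left) (auto simp: coeff_eq_0)

lemma poly_apply_linear_factor:
  "poly_apply ([:-l, 1:] * q) N z = poly_apply q N (N *v z - l *s z)"
proof -
  let ?K = "degree q"
  have pow: "((*v) N ^^ i) (N *v z - l *s z) = ((*v) N ^^ Suc i) z - l *s ((*v) N ^^ i) z" for i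
  proof (induction i)
    case (Suc i)
    then show ?case
      by (simp add: matrix_vector_mult_diff_distrib vec.scale)
  qed simp
  have "[:-l, 1:] * q = pCons 0 q - smult l q" by simp
  moreover have "degree (pCons 0 q - smult l q) \<le> Suc ?K"
    by (intro degree_diff_le degree_pCons_le) (simp add: le_SucI)
  ultimately have "poly_apply ([:-l, 1:] * q) N z
      = (\<Sum>i\<le>Suc ?K. coeff (pCons 0 q - smult l q) i *s ((*v) N ^^ i) z)"
    by (metis poly_apply_eq)
  also have "\<dots> = (\<Sum>i\<le>Suc ?K. coeff (pCons 0 q) i *s ((*v) N ^^ i) z)
      - (\<Sum>i\<le>Suc ?K. (l * coeff q i) *s ((*v) N ^^ i) z)"
    by (simp only: coeff_diff coeff_smult vec.scale_left_diff_distrib sum_subtractf)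
  also have "(\<Sum>i\<le>Suc ?K. coeff (pCons 0 q) i *s ((*v) N ^^ i) z)
      = (\<Sum>i\<le>?K. coeff q i *s ((*v) N ^^ Suc i) z)"
    by (subst sum.atMost_Suc_shift) simp
  also have "(\<Sum>i\<le>Suc ?K. (l * coeff q i) *s ((*v) N ^^ i) z)
      = (\<Sum>i\<le>?K. (l * coeff q i) *s ((*v) N ^^ i) z)"
    by (simp add: coeff_eq_0)
  finally show ?thesis
    unfolding poly_apply_def[of q] pow
    by (simp add: sum_subtractf vec.scale_right_diff_distrib mult.commute)
qed

lemma annihilating_poly_exists:
  fixes N :: "complex^'n^'n"
  obtains p where "p \<noteq> 0" "poly_apply p N z = 0"
\<comment> \<open>Linear dependence is a property of sets and does not detect coinciding iterates,
  so a repetition gets its own polynomial, a difference of two monomials.\<close>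
proof (cases "inj_on (\<lambda>i. ((*v) N ^^ i) z) {..CARD('n)}")
  case False
  then obtain i j where ij: "i \<noteq> j" "((*v) N ^^ i) z = ((*v) N ^^ j) z"
    by (auto simp: inj_on_def)
  let ?p = "monom 1 i - monom 1 j :: complex poly"
  have "degree ?p \<le> i + j"
    by (intro degree_diff_le) (auto intro: order_trans[OF degree_monom_le])
  then have "poly_apply ?p N z = (\<Sum>k\<le>i+j. coeff ?p k *s ((*v) N ^^ k) z)"
    by (rule poly_apply_eq)
  also have "\<dots> = (\<Sum>k\<le>i+j. coeff (monom 1 i) k *s ((*v) N ^^ k) z)
      - (\<Sum>k\<le>i+j. coeff (monom 1 j) k *s ((*v) N ^^ k) z)"
    by (simp only: coeff_diff vec.scale_left_diff_distrib sum_subtractf)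
  also have "\<dots> = 0"
    using ij(2) by (simp add: if_distrib[of "\<lambda>c. c *s _"] cong: if_cong)
  finally have "poly_apply ?p N z = 0" .
  moreover have "?p \<noteq> 0"
    using ij(1) by (metis coeff_monom diff_eq_eq add_0 zero_neq_one)
  ultimately show ?thesis using that by blast
next
  case True
  let ?h = "\<lambda>i. ((*v) N ^^ i) z"
  let ?S = "?h ` {..CARD('n)}"
  have "card ?S = Suc CARD('n)" using card_image[OF True] by simp
  then have "vec.dependent ?S"
    by (metis dim_subset_UNIV_cart_gen lessI linorder_not_le vec.dim_eq_card_independent)
  then obtain u where u: "\<exists>v\<in>?S. u v \<noteq> 0" "(\<Sum>v\<in>?S. u v *s v) = 0"
    using vec.dependent_finite[of ?S] by blast
  let ?p = "\<Sum>i\<le>CARD('n). monom (u (?h i)) i"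
  have coeff: "coeff ?p i = (if i \<le> CARD('n) then u (?h i) else 0)" for i
    by (simp add: coeff_sum)
  have "degree ?p \<le> CARD('n)"
    by (rule degree_le) (simp add: coeff)
  then have "poly_apply ?p N z = (\<Sum>i\<le>CARD('n). u (?h i) *s ?h i)"
    by (subst poly_apply_eq) (auto simp: coeff)
  also have "\<dots> = 0"
    using u(2) by (simp add: sum.reindex[OF True])
  finally have "poly_apply ?p N z = 0" .
  moreover obtain i where "i \<le> CARD('n)" "u (?h i) \<noteq> 0" using u(1) by auto
  then have "coeff ?p i \<noteq> 0" by (simp add: coeff)
  then have "?p \<noteq> 0" by (metis coeff_0)
  ultimately show ?thesis using that by blast
qed

text \<open>If \<open>l\<close> is no eigenvalue on \<open>Z\<close>, then \<open>N - l\<close> is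
  injective there. It commutes with the factors of the chain, so it can be pushed through to the end
  of the chain and cancelled at 0.\<close>

lemma eigen_chain_skip:
  assumes "eigen_chain N L Z u"
    and inv: "\<And>z. z \<in> Z \<Longrightarrow> N *v z \<in> Z" and sub: "vec.subspace Z"
    and l: "\<And>z. z \<in> Z \<Longrightarrow> N *v z = l *s z \<Longrightarrow> z = 0"
    and "u = N *v z - l *s z" "z \<in> Z"
  shows "eigen_chain N L Z z"
  using assms(1,5,6)
proof (induction arbitrary: z)
  case zero
  then have "z = 0" using l by (metis eq_iff_diff_eq_0)
  then show ?case by (simp add: eigen_chain.zero)
next
  case (step u m)
  let ?z' = "N *v z - m *s z"
  have "?z' \<in> Z"
    using step.prems inv sub by (simp add: vec.subspace_diff vec.subspace_scale)
  moreover have "N *v u - m *s u = N *v ?z' - l *s ?z'"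
    unfolding step.prems
    by (simp add: matrix_vector_mult_diff_distrib vec.scale vec.scale_right_diff_distrib mult.commute)
  ultimately have "eigen_chain N L Z ?z'" using step.IH by blast
  then show ?case using step by (blast intro: eigen_chain.step)
qed

text \<open>An annihilating polynomial is stripped of one root at a time. It need not be minimal, so
  some roots may not be eigenvalues on \<open>Z\<close>; those outside \<open>L\<close> are
  discarded by \<open>eigen_chain_skip\<close>.\<close>

lemma eigen_chain_all:
  assumes inv: "\<And>z. z \<in> Z \<Longrightarrow> N *v z \<in> Z" and sub: "vec.subspace Z"
    and L: "\<And>z l. z \<in> Z \<Longrightarrow> z \<noteq> 0 \<Longrightarrow> N *v z = l *s z \<Longrightarrow> l \<in> L"
    and z: "z \<in> Z"
  shows "eigen_chain N L Z z"
proof -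
  have "eigen_chain N L Z z" if "p \<noteq> 0" "poly_apply p N z = 0" "z \<in> Z" for p z
    using that
  proof (induction "degree p" arbitrary: p z)
    case 0
    then obtain c where "p = [:c:]" by (metis degree_eq_zeroE)
    with 0 have "z = 0" by (simp add: poly_apply_def vec.scale_eq_0_iff)
    then show ?case by (simp add: eigen_chain.zero)
  next
    case (Suc n)
    then have "\<not> constant (poly p)" by (simp add: constant_degree)
    then obtain l where "poly p l = 0" using fundamental_theorem_of_algebra by blast
    then obtain q where q: "p = [:-l, 1:] * q" by (auto simp: poly_eq_0_iff_dvd dvd_def)
    then have q0: "q \<noteq> 0" using Suc by auto
    have "degree p = Suc (degree q)"
      unfolding q using q0 by (subst degree_mult_eq) auto
    moreover have mem: "N *v z - l *s z \<in> Z"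
      using Suc.prems inv sub by (simp add: vec.subspace_diff vec.subspace_scale)
    moreover have "poly_apply q N (N *v z - l *s z) = 0"
      using Suc.prems(2) unfolding q poly_apply_linear_factor .
    ultimately have ch: "eigen_chain N L Z (N *v z - l *s z)"
      using Suc.hyps q0 by simp
    show ?case
    proof (cases "l \<in> L")
      case True
      then show ?thesis using ch Suc.prems by (blast intro: eigen_chain.step)
    next
      case False
      then have "\<And>z. z \<in> Z \<Longrightarrow> N *v z = l *s z \<Longrightarrow> z = 0" using L by blast
      from eigen_chain_skip[OF ch inv sub this refl] Suc.prems show ?thesis by blast
    qed
  qed
  with annihilating_poly_exists z show ?thesis by metis
qed

section \<open>Kernel of the pencil\<close>

definition re_vec :: "complex^'n \<Rightarrow> real^'n" where "re_vec z = (\<chi> i. Re (z $ i))"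
definition im_vec :: "complex^'n \<Rightarrow> real^'n" where "im_vec z = (\<chi> i. Im (z $ i))"
definition cvec :: "real^'n \<Rightarrow> complex^'n" where "cvec v = (\<chi> i. complex_of_real (v $ i))"

lemma re_vec_mult: "re_vec (complex_matrix M *v z) = M *v re_vec z"
  and im_vec_mult: "im_vec (complex_matrix M *v z) = M *v im_vec z"
  by (simp_all add: vec_eq_iff re_vec_def im_vec_def complex_matrix_def matrix_vector_mult_def)

lemma re_vec_simps [simp]:
  "re_vec (x + y) = re_vec x + re_vec y" "re_vec (x - y) = re_vec x - re_vec y" "re_vec 0 = 0"
  "re_vec (complex_of_real r *s x) = r *\<^sub>R re_vec x" "re_vec (cvec v) = v"
  by (simp_all add: vec_eq_iff re_vec_def cvec_def)

lemma im_vec_simps [simp]: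
  "im_vec (x + y) = im_vec x + im_vec y" "im_vec (x - y) = im_vec x - im_vec y" "im_vec 0 = 0"
  "im_vec (complex_of_real r *s x) = r *\<^sub>R im_vec x" "im_vec (cvec v) = 0"
  by (simp_all add: vec_eq_iff im_vec_def cvec_def)

lemma complex_matrix_cvec: "complex_matrix M *v cvec v = cvec (M *v v)"
  by (simp add: vec_eq_iff cvec_def complex_matrix_def matrix_vector_mult_def)

lemma mat_vector_mult: "(mat s :: real^'n^'n) *v v = s *\<^sub>R v"
  by (simp add: vec_eq_iff matrix_vector_mult_def mat_def if_distrib[of "\<lambda>c. c * _"] cong: if_cong)

lemma complex_matrix_closed_loop:
  "complex_matrix (M + N ** F) *v z = complex_matrix M *v z + complex_matrix N *v (complex_matrix F *v z)"
proof -
  have "re_vec (complex_matrix (M + N ** F) *v z)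
      = re_vec (complex_matrix M *v z + complex_matrix N *v (complex_matrix F *v z))"
    "im_vec (complex_matrix (M + N ** F) *v z)
      = im_vec (complex_matrix M *v z + complex_matrix N *v (complex_matrix F *v z))"
    by (simp_all add: re_vec_mult im_vec_mult matrix_vector_mult_add_rdistrib flip: matrix_vector_mul_assoc)
  then show ?thesis by (simp add: vec_eq_iff re_vec_def im_vec_def complex_eq_iff)
qed

text \<open>State parts of the real kernel of the pencil at \<open>s\<close>. Despite the name they
  may be nonzero where \<open>s\<close> is no invariant zero, namely when the pencil has a kernel
  for generic \<open>s\<close>.\<close>

definition zero_directions ::
  "real^'n^'n \<Rightarrow> real^'m^'n \<Rightarrow> real^'n^'p \<Rightarrow> real^'m^'p \<Rightarrow> real \<Rightarrow> (real^'n) set" where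
  "zero_directions A B C D s = {v. \<exists>w. A *v v + B *v w = s *\<^sub>R v \<and> C *v v + D *v w = 0}"

definition stable_zero_span ::
  "time_domain \<Rightarrow> real^'n^'n \<Rightarrow> real^'m^'n \<Rightarrow> real^'n^'p \<Rightarrow> real^'m^'p \<Rightarrow> (real^'n) set" where
  "stable_zero_span td A B C D =
     span (\<Union>s\<in>{s. complex_of_real s \<in> stable_region td}. zero_directions A B C D s)"

lemma zero_directions_complex:
  assumes "complex_matrix A *v x - complex_of_real s *s x + complex_matrix B *v y = 0"
    and "complex_matrix C *v x + complex_matrix D *v y = 0"
  shows "re_vec x \<in> zero_directions A B C D s" "im_vec x \<in> zero_directions A B C D s"
proof -
  have "A *v re_vec x - s *\<^sub>R re_vec x + B *v re_vec y = 0" "C *v re_vec x + D *v re_vec y = 0"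
    "A *v im_vec x - s *\<^sub>R im_vec x + B *v im_vec y = 0" "C *v im_vec x + D *v im_vec y = 0"
    using arg_cong[OF assms(1), of re_vec] arg_cong[OF assms(1), of im_vec]
      arg_cong[OF assms(2), of re_vec] arg_cong[OF assms(2), of im_vec]
    by (simp_all add: re_vec_mult im_vec_mult)
  then have "A *v re_vec x + B *v re_vec y = s *\<^sub>R re_vec x \<and> C *v re_vec x + D *v re_vec y = 0"
    "A *v im_vec x + B *v im_vec y = s *\<^sub>R im_vec x \<and> C *v im_vec x + D *v im_vec y = 0"
    by (simp_all add: algebra_simps)
  then show "re_vec x \<in> zero_directions A B C D s" "im_vec x \<in> zero_directions A B C D s"
    unfolding zero_directions_def by blast+
qed

section \<open>Evaluation, minors and local inverses of the system pencil\<close>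

lemma system_matrix_eval: "system_matrix A B C D s = eval_matrix (system_pencil A B C D) s"
  by (simp add: system_matrix_def eval_matrix_def)

lemma sum_UNIV_sum:
  "sum g (UNIV :: ('a::finite + 'b::finite) set) = (\<Sum>i\<in>UNIV. g (Inl i)) + (\<Sum>i\<in>UNIV. g (Inr i))"
  using sum.Plus[of "UNIV :: 'a set" "UNIV :: 'b set" g] by (simp add: UNIV_Plus_UNIV o_def)

lemma system_matrix_mult:
  fixes A :: "real^'n^'n" and B :: "real^'m^'n" and C :: "real^'n^'p" and D :: "real^'m^'p"
  shows "(system_matrix A B C D s *v y) $ Inl i
      = (complex_matrix A *v (\<chi> j. y $ Inl j) - s *s (\<chi> j. y $ Inl j)
          + complex_matrix B *v (\<chi> j. y $ Inr j)) $ i"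
    and "(system_matrix A B C D s *v y) $ Inr l
      = (complex_matrix C *v (\<chi> j. y $ Inl j) + complex_matrix D *v (\<chi> j. y $ Inr j)) $ l"
proof -
  have "(\<Sum>j\<in>UNIV. poly [:complex_of_real (A $ i $ j), if i = j then - 1 else 0:] s * y $ Inl j)
     = (\<Sum>j\<in>UNIV. complex_of_real (A $ i $ j) * y $ Inl j - (if i = j then s * y $ Inl j else 0))"
    by (intro sum.cong) (auto simp: algebra_simps)
  then show "(system_matrix A B C D s *v y) $ Inl i
      = (complex_matrix A *v (\<chi> j. y $ Inl j) - s *s (\<chi> j. y $ Inl j)
          + complex_matrix B *v (\<chi> j. y $ Inr j)) $ i"
    by (simp add: matrix_vector_mult_def system_matrix_def system_pencil_def sum_UNIV_sum
        complex_matrix_def sum_subtractf)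
  show "(system_matrix A B C D s *v y) $ Inr l
      = (complex_matrix C *v (\<chi> j. y $ Inl j) + complex_matrix D *v (\<chi> j. y $ Inr j)) $ l"
    by (simp add: matrix_vector_mult_def system_matrix_def system_pencil_def sum_UNIV_sum
        complex_matrix_def)
qed

lemma normal_rank_right_invertible:
  fixes A :: "real^'n^'n" and B :: "real^'m^'n" and C :: "real^'n^'p" and D :: "real^'m^'p"
  assumes "right_invertible A B C D"
  shows "normal_rank A B C D = CARD('n + 'p)"
    and "\<exists>s. rank (system_matrix A B C D s) = CARD('n + 'p)"
proof -
  have "\<exists>s. s \<notin> {s. rank (system_matrix A B C D s) \<noteq> CARD('n) + CARD('p)}"
    using assms unfolding right_invertible_def by (metis ex_new_if_finite infinite_UNIV_char_0)
  then show ex: "\<exists>s. rank (system_matrix A B C D s) = CARD('n + 'p)" by simp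
  have "range (\<lambda>s. rank (system_matrix A B C D s)) \<subseteq> {..CARD('n + 'p)}"
    using rank_le_rows by blast
  moreover from this have "finite (range (\<lambda>s. rank (system_matrix A B C D s)))"
    by (rule finite_subset) simp
  ultimately show "normal_rank A B C D = CARD('n + 'p)"
    unfolding normal_rank_def using ex
    by (intro Max_eqI) (blast, blast, metis rangeI)
qed

text \<open>A power dividing all maximal minors divides their gcd, the zero polynomial, and at a
  zero semisimplicity makes its order equal to the corank. The order is informative because the gcd
  is nonzero: right invertibility provides a point of full rank and hence a nonvanishing minor. Away
  from the zeros the corank is 0 and some minor does not vanish at \<open>z\<close>.\<close>

lemma pencil_minor_nondivisible:
  fixes A :: "real^'n^'n" and B :: "real^'m^'n" and C :: "real^'n^'p" and D :: "real^'m^'p"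
  assumes ri: "right_invertible A B C D"
    and ss: "z \<in> invariant_zeros A B C D \<Longrightarrow>
          algebraic_multiplicity A B C D z = geometric_multiplicity A B C D z"
  shows "\<exists>f :: 'n + 'p \<Rightarrow> 'n + 'm.
    \<not> [:-z, 1:] ^ Suc (CARD('n + 'p) - rank (system_matrix A B C D z))
       dvd det (select_columns f (system_pencil A B C D))"
proof (cases "z \<in> invariant_zeros A B C D")
  case True
  let ?P = "system_pencil A B C D"
  let ?g = "CARD('n + 'p) - rank (system_matrix A B C D z)"
  have zp: "zero_polynomial A B C D = Gcd (range (\<lambda>f. det (select_columns f ?P)))"
    by (simp add: zero_polynomial_def select_columns_def)
  obtain s where "rank (eval_matrix ?P s) = CARD('n + 'p)"
    using normal_rank_right_invertible(2)[OF ri] by (auto simp: system_matrix_eval)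
  then obtain f where f: "det (select_columns f (eval_matrix ?P s)) \<noteq> 0"
    by (rule full_row_rank_minor)
  have "poly (det (select_columns f ?P)) s \<noteq> 0"
    using f by (simp add: poly_det eval_matrix_def select_columns_def)
  then have "det (select_columns f ?P) \<noteq> 0" by auto
  moreover have "zero_polynomial A B C D dvd det (select_columns f ?P)"
    unfolding zp by (intro Gcd_dvd) auto
  ultimately have nz: "zero_polynomial A B C D \<noteq> 0" by auto
  have "order z (zero_polynomial A B C D) = ?g"
    using ss[OF True] normal_rank_right_invertible(1)[OF ri]
    by (simp add: algebraic_multiplicity_def geometric_multiplicity_def)
  then have "\<not> [:-z, 1:] ^ Suc ?g dvd zero_polynomial A B C D"
    using nz by (simp add: order_divides del: power_Suc)
  then show ?thesis unfolding zp using Gcd_greatest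
    by (metis (no_types, lifting) rangeE)
next
  case False
  let ?P = "system_pencil A B C D"
  have "rank (system_matrix A B C D z) = CARD('n + 'p)"
    using False rank_le_rows[of "system_matrix A B C D z"] normal_rank_right_invertible(1)[OF ri]
    by (simp add: invariant_zeros_def)
  then have g: "rank (eval_matrix ?P z) = CARD('n + 'p)" by (simp add: system_matrix_eval)
  then obtain f where f: "det (select_columns f (eval_matrix ?P z)) \<noteq> 0"
    by (rule full_row_rank_minor)
  have "poly (det (select_columns f ?P)) z \<noteq> 0"
    using f by (simp add: poly_det eval_matrix_def select_columns_def)
  then show ?thesis using g by (auto simp: system_matrix_eval poly_eq_0_iff_dvd)
qed

text \<open>Right-hand sides supported on the state rows keep the output at zero, and at
  \<open>s = z\<close> they vanish, so the solution there lies in the kernel of the pencil. A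
  nonreal \<open>z\<close> offers no real zero direction, but it is no invariant zero either; the
  corank is 0 and \<open>q\<close> can be chosen to vanish at \<open>z\<close>.\<close>

lemma system_local_inverse:
  fixes A :: "real^'n^'n" and B :: "real^'m^'n" and C :: "real^'n^'p" and D :: "real^'m^'p"
  assumes ri: "right_invertible A B C D"
    and ss: "z \<in> invariant_zeros A B C D \<Longrightarrow>
          algebraic_multiplicity A B C D z = geometric_multiplicity A B C D z"
    and real: "z \<in> invariant_zeros A B C D \<Longrightarrow> z \<in> \<real>"
  shows "\<exists>d. poly d z \<noteq> 0 \<and>
    (\<forall>e :: complex^'n. \<exists>(q :: complex poly^'n) (r :: complex poly^'m).
       (\<forall>s. complex_matrix A *v eval_vector q s - s *s eval_vector q s
              + complex_matrix B *v eval_vector r s = ((s - z) * poly d s) *s e \<and>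
            complex_matrix C *v eval_vector q s + complex_matrix D *v eval_vector r s = 0) \<and>
       (z \<notin> \<real> \<longrightarrow> eval_vector q z = 0))"
proof -
  let ?P = "system_pencil A B C D"
  let ?g = "CARD('n + 'p) - rank (system_matrix A B C D z)"
  obtain f :: "'n + 'p \<Rightarrow> 'n + 'm" where f: "\<not> [:-z, 1:] ^ Suc ?g dvd det (select_columns f ?P)"
    using pencil_minor_nondivisible[OF ri ss] by blast
  have g: "CARD('n + 'p) = rank (eval_matrix ?P z) + ?g"
    using rank_le_rows[of "system_matrix A B C D z"] by (simp add: system_matrix_eval)
  obtain d where d: "poly d z \<noteq> 0"
    "\<And>e :: complex^('n + 'p). \<exists>q :: complex poly^('n + 'm).
       (\<forall>s. eval_matrix ?P s *v eval_vector q s = ((s - z) * poly d s) *s e) \<and>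
       (?g = 0 \<longrightarrow> eval_vector q z = 0)"
    using semisimple_local_inverse[OF g f] by metis
  have g0: "?g = 0" if "z \<notin> \<real>"
  proof -
    have "z \<notin> invariant_zeros A B C D" using that real by blast
    then show ?thesis
      using normal_rank_right_invertible(1)[OF ri] by (simp add: invariant_zeros_def)
  qed
  have "\<exists>(q :: complex poly^'n) (r :: complex poly^'m).
       (\<forall>s. complex_matrix A *v eval_vector q s - s *s eval_vector q s
              + complex_matrix B *v eval_vector r s = ((s - z) * poly d s) *s e \<and>
            complex_matrix C *v eval_vector q s + complex_matrix D *v eval_vector r s = 0) \<and>
       (z \<notin> \<real> \<longrightarrow> eval_vector q z = 0)" for e :: "complex^'n"
  proof -
    let ?e = "(\<chi> k. case k of Inl i \<Rightarrow> e $ i | Inr l \<Rightarrow> 0) :: complex^('n + 'p)"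
    obtain y :: "complex poly^('n + 'm)" where
      y: "\<And>s. system_matrix A B C D s *v eval_vector y s = ((s - z) * poly d s) *s ?e"
      and y0: "?g = 0 \<longrightarrow> eval_vector y z = 0"
      using d(2)[of ?e] by (auto simp: system_matrix_eval)
    let ?q = "(\<chi> j. y $ Inl j) :: complex poly^'n" and ?r = "(\<chi> j. y $ Inr j) :: complex poly^'m"
    have q: "eval_vector ?q s = (\<chi> j. eval_vector y s $ Inl j)" for s
      by (simp add: eval_vector_def)
    have r: "eval_vector ?r s = (\<chi> j. eval_vector y s $ Inr j)" for s
      by (simp add: eval_vector_def)
    have "complex_matrix A *v eval_vector ?q s - s *s eval_vector ?q s
              + complex_matrix B *v eval_vector ?r s = ((s - z) * poly d s) *s e" for s
      unfolding vec_eq_iff q r system_matrix_mult(1)[of A B C D, symmetric] y by simp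
    moreover have "complex_matrix C *v eval_vector ?q s + complex_matrix D *v eval_vector ?r s = 0" for s
      unfolding vec_eq_iff q r system_matrix_mult(2)[of A B C D s, symmetric] y by simp
    moreover have "eval_vector ?q z = 0" if "z \<notin> \<real>"
      unfolding q using y0 g0[OF that] by (simp add: vec_eq_iff)
    ultimately show ?thesis by blast
  qed
  with d(1) show ?thesis by blast
qed

section \<open>The largest stabilizability output-nulling subspace\<close>

text \<open>Bilinear, without conjugation, so that pairing with \<open>eval_vector q s\<close> is a
  polynomial in \<open>s\<close>.\<close>

definition cdot :: "real^'n \<Rightarrow> complex^'n \<Rightarrow> complex" where
  "cdot a z = (\<Sum>i\<in>UNIV. complex_of_real (a $ i) * z $ i)"

lemma cdot_add: "cdot a (x + y) = cdot a x + cdot a y"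
  and cdot_scale: "cdot a (c *s x) = c * cdot a x"
  by (simp_all add: cdot_def distrib_left sum.distrib sum_distrib_left mult.left_commute)

lemma cdot_eq_0_iff: "cdot a z = 0 \<longleftrightarrow> a \<bullet> re_vec z = 0 \<and> a \<bullet> im_vec z = 0"
  by (simp add: cdot_def complex_eq_iff inner_vec_def re_vec_def im_vec_def)

lemma cdot_eval_vector: "cdot a (eval_vector q s) = poly (\<Sum>i\<in>UNIV. smult (complex_of_real (a $ i)) (q $ i)) s"
  by (simp add: cdot_def eval_vector_def poly_sum)

lemma infinite_real_stable: "infinite {s. complex_of_real s \<in> stable_region td}"
proof (cases td)
  case Continuous
  then show ?thesis using infinite_Iio[of "0 :: real"] by (simp add: lessThan_def)
next
  case Discrete
  have "infinite {0<..<1::real}" by (simp add: infinite_Ioo)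
  moreover have "{0<..<1::real} \<subseteq> {s. complex_of_real s \<in> stable_region td}"
    using Discrete by auto
  ultimately show ?thesis using finite_subset by blast
qed

lemma zero_directions_stable_zero_span:
  "complex_of_real s \<in> stable_region td \<Longrightarrow> zero_directions A B C D s \<subseteq> stable_zero_span td A B C D"
  unfolding stable_zero_span_def by (intro order_trans[OF _ span_superset]) auto

text \<open>
  Adding the vectors of an eigenvector chain one at a time builds polynomials \<open>(q, r)\<close> that the
  pencil maps to multiples of the last vector. Correcting them by the local inverse at the
  current eigenvalue gives kernel polynomials, and those are determined by their values at real
  stable points.
\<close>

lemma eigen_chain_orthogonal:
  fixes A :: "real^'n^'n" and B :: "real^'m^'n" and C :: "real^'n^'p" and D :: "real^'m^'p"
    and F :: "real^'n^'m"
  assumes ri: "right_invertible A B C D"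
    and ss: "\<And>z. z \<in> minimum_phase_zeros td A B C D \<Longrightarrow>
          algebraic_multiplicity A B C D z = geometric_multiplicity A B C D z"
    and real: "minimum_phase_zeros td A B C D \<subseteq> \<real>"
    and a: "\<And>v. v \<in> stable_zero_span td A B C D \<Longrightarrow> a \<bullet> v = 0"
    and null: "\<And>z. z \<in> Z \<Longrightarrow> complex_matrix C *v z + complex_matrix D *v (complex_matrix F *v z) = 0"
    and "eigen_chain (complex_matrix (A + B ** F)) (stable_region td) Z z"
  shows "cdot a z = 0 \<and> (\<exists>(q :: complex poly^'n) (r :: complex poly^'m) p. p \<noteq> 0 \<and>
      (\<forall>s. complex_matrix A *v eval_vector q s - s *s eval_vector q s
              + complex_matrix B *v eval_vector r s = - poly p s *s z \<and>
            complex_matrix C *v eval_vector q s + complex_matrix D *v eval_vector r s = 0 \<and>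
            cdot a (eval_vector q s) = 0))"
  using assms(6)
proof induction
  case zero
  have eval_0: "eval_vector (0 :: complex poly^'k) s = 0" for s
    by (simp add: eval_vector_def vec_eq_iff)
  show ?case
    by (rule conjI, simp add: cdot_def, rule exI[of _ 0], rule exI[of _ 0], rule exI[of _ 1])
      (simp add: cdot_def eval_0)
next
  case (step z l)
  let ?A = "complex_matrix A" and ?B = "complex_matrix B"
    and ?C = "complex_matrix C" and ?D = "complex_matrix D" and ?F = "complex_matrix F"
  let ?u = "complex_matrix (A + B ** F) *v z - l *s z"
  obtain q r p where p: "p \<noteq> 0" and
    state: "\<And>s. ?A *v eval_vector q s - s *s eval_vector q s + ?B *v eval_vector r s = - poly p s *s ?u"
    and out: "\<And>s. ?C *v eval_vector q s + ?D *v eval_vector r s = 0"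
    and ortho: "\<And>s. cdot a (eval_vector q s) = 0"
    using step.IH by blast
  \<comment> \<open>With \<open>N\<close> the closed-loop matrix,
    \<open>(N - s) z = u + (l - s) z\<close>. Adding \<open>p z\<close> to the state and
    \<open>p F z\<close> to the input therefore cancels \<open>- p u\<close> and leaves
    \<open>- (s - l) p z\<close>.\<close>
  define q' where "q' = (\<chi> i. q $ i + smult (z $ i) p)"
  define r' where "r' = (\<chi> i. r $ i + smult ((?F *v z) $ i) p)"
  define p' where "p' = [:-l, 1:] * p"
  have q': "eval_vector q' s = eval_vector q s + poly p s *s z" for s
    by (simp add: q'_def eval_vector_def vec_eq_iff mult.commute)
  have r': "eval_vector r' s = eval_vector r s + poly p s *s (?F *v z)" for s
    by (simp add: r'_def eval_vector_def vec_eq_iff mult.commute)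
  have "p' \<noteq> 0" using p by (simp add: p'_def del: mult_pCons_left)
  have state': "?A *v eval_vector q' s - s *s eval_vector q' s + ?B *v eval_vector r' s = - poly p' s *s z" for s
  proof -
    have "?A *v eval_vector q' s - s *s eval_vector q' s + ?B *v eval_vector r' s
       = (?A *v eval_vector q s - s *s eval_vector q s + ?B *v eval_vector r s)
         + poly p s *s (?A *v z + ?B *v (?F *v z) - s *s z)"
      unfolding q' r' by (simp add: matrix_vector_right_distrib vec.scale algebra_simps
          vec.scale_right_distrib vec.scale_right_diff_distrib)
    also have "\<dots> = - poly p' s *s z"
      unfolding state complex_matrix_closed_loop p'_def
      by (simp add: vec_eq_iff algebra_simps)
    finally show ?thesis .
  qed
  have out': "?C *v eval_vector q' s + ?D *v eval_vector r' s = 0" for s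
  proof -
    have "?C *v eval_vector q' s + ?D *v eval_vector r' s
      = (?C *v eval_vector q s + ?D *v eval_vector r s) + poly p s *s (?C *v z + ?D *v (?F *v z))"
      unfolding q' r' by (simp add: matrix_vector_right_distrib vec.scale algebra_simps
          vec.scale_right_distrib)
    then show ?thesis using out null[OF step.hyps(1)] by simp
  qed
  have az: "cdot a z = 0"
  proof -
    have ss_l: "l \<in> invariant_zeros A B C D \<Longrightarrow>
        algebraic_multiplicity A B C D l = geometric_multiplicity A B C D l"
      and real_l: "l \<in> invariant_zeros A B C D \<Longrightarrow> l \<in> \<real>"
      using ss real step.hyps(2) by (auto simp: minimum_phase_zeros_def)
    obtain d where d: "poly d l \<noteq> 0" and loc: "\<forall>e :: complex^'n. \<exists>q r.
       (\<forall>s. ?A *v eval_vector q s - s *s eval_vector q s + ?B *v eval_vector r s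
              = ((s - l) * poly d s) *s e \<and>
            ?C *v eval_vector q s + ?D *v eval_vector r s = 0) \<and>
       (l \<notin> \<real> \<longrightarrow> eval_vector q l = 0)"
      using system_local_inverse[OF ri ss_l real_l] by blast
    obtain q2 r2 where
      state2: "\<And>s. ?A *v eval_vector q2 s - s *s eval_vector q2 s + ?B *v eval_vector r2 s
              = ((s - l) * poly d s) *s z"
      and out2: "\<And>s. ?C *v eval_vector q2 s + ?D *v eval_vector r2 s = 0"
      and nonreal: "l \<notin> \<real> \<longrightarrow> eval_vector q2 l = 0"
      using loc by blast
    \<comment> \<open>The right-hand side of \<open>state2\<close> vanishes at \<open>l\<close>. For
      real \<open>l\<close> the real and imaginary parts of \<open>q2(l)\<close> are therefore zero
      directions.\<close>
    have aq2: "cdot a (eval_vector q2 l) = 0"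
    proof (cases "l \<in> \<real>")
      case True
      then obtain t where t: "l = complex_of_real t" by (auto elim: Reals_cases)
      have "re_vec (eval_vector q2 l) \<in> zero_directions A B C D t"
        "im_vec (eval_vector q2 l) \<in> zero_directions A B C D t"
        using zero_directions_complex[of A "eval_vector q2 l" t B "eval_vector r2 l" C D]
          state2[of l] out2[of l] t by simp_all
      then show ?thesis
        using zero_directions_stable_zero_span step.hyps(2) t a cdot_eq_0_iff by blast
    next
      case False
      then show ?thesis using nonreal by (simp add: cdot_def)
    qed
    \<comment> \<open>The targets \<open>- (s - l) p z\<close> and \<open>(s - l) d z\<close> cancel
      under the cross weights \<open>d\<close> and \<open>p\<close>.\<close>
    define x where "x = (\<chi> i. d * q' $ i + p * q2 $ i)"
    define y where "y = (\<chi> i. d * r' $ i + p * r2 $ i)"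
    have x: "eval_vector x s = poly d s *s eval_vector q' s + poly p s *s eval_vector q2 s" for s
      by (simp add: x_def eval_vector_def vec_eq_iff)
    have y: "eval_vector y s = poly d s *s eval_vector r' s + poly p s *s eval_vector r2 s" for s
      by (simp add: y_def eval_vector_def vec_eq_iff)
    have ker1: "?A *v eval_vector x s - s *s eval_vector x s + ?B *v eval_vector y s = 0" for s
    proof -
      have "?A *v eval_vector x s - s *s eval_vector x s + ?B *v eval_vector y s
        = poly d s *s (?A *v eval_vector q' s - s *s eval_vector q' s + ?B *v eval_vector r' s)
        + poly p s *s (?A *v eval_vector q2 s - s *s eval_vector q2 s + ?B *v eval_vector r2 s)"
        unfolding x y by (simp add: matrix_vector_right_distrib vec.scale algebra_simps
          vec.scale_right_distrib vec.scale_right_diff_distrib)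
      also have "\<dots> = 0"
        unfolding state' state2 p'_def by (simp add: vec_eq_iff algebra_simps)
      finally show ?thesis .
    qed
    have ker2: "?C *v eval_vector x s + ?D *v eval_vector y s = 0" for s
    proof -
      have "?C *v eval_vector x s + ?D *v eval_vector y s
        = poly d s *s (?C *v eval_vector q' s + ?D *v eval_vector r' s)
        + poly p s *s (?C *v eval_vector q2 s + ?D *v eval_vector r2 s)"
        unfolding x y by (simp add: matrix_vector_right_distrib vec.scale algebra_simps
          vec.scale_right_distrib)
      then show ?thesis using out' out2 by simp
    qed
    \<comment> \<open>The multiplier \<open>p\<close> may vanish at \<open>l\<close> when that
      eigenvalue recurs in the chain. It is a common factor of the pairing with \<open>a\<close>, so
      it is split off and cancelled before evaluating at \<open>l\<close>.\<close>
    define t where "t = smult (cdot a z) d + (\<Sum>i\<in>UNIV. smult (complex_of_real (a $ i)) (q2 $ i))"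
    have ax: "cdot a (eval_vector x s) = poly (p * t) s" for s
    proof -
      have "cdot a (eval_vector x s)
        = poly d s * (cdot a (eval_vector q s) + poly p s * cdot a z) + poly p s * cdot a (eval_vector q2 s)"
        unfolding x q' by (simp add: cdot_add cdot_scale distrib_left)
      then show ?thesis
        unfolding ortho t_def by (simp add: cdot_eval_vector algebra_simps)
    qed
    have "poly (p * t) (complex_of_real s) = 0" if "complex_of_real s \<in> stable_region td" for s
      unfolding ax[symmetric] cdot_eq_0_iff
      using zero_directions_complex[OF ker1 ker2, of s] zero_directions_stable_zero_span[OF that] a
      by blast
    then have "complex_of_real ` {s. complex_of_real s \<in> stable_region td} \<subseteq> {s. poly (p * t) s = 0}"
      by blast
    moreover have "infinite (complex_of_real ` {s. complex_of_real s \<in> stable_region td})"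
      using infinite_real_stable[of td] by (simp add: finite_image_iff inj_on_def)
    ultimately have "p * t = 0"
      using poly_roots_finite finite_subset by blast
    then have "t = 0" using p by simp
    then have "poly t l = 0" by simp
    then have "cdot a z * poly d l + cdot a (eval_vector q2 l) = 0"
      by (simp add: t_def cdot_eval_vector)
    then show ?thesis using aq2 d by simp
  qed
  moreover have "cdot a (eval_vector q' s) = 0" for s
    unfolding q' by (simp add: cdot_add cdot_scale ortho az)
  ultimately show ?case
    using \<open>p' \<noteq> 0\<close> state' out' by blast
qed

text \<open>By orthogonal decomposition it suffices that every functional vanishing on the span
  vanishes on \<open>V\<close>. The complexification of \<open>V\<close> is invariant, so each of
  its vectors has an eigenvector chain with stable eigenvalues, whether or not the restriction is
  diagonalizable.\<close>

lemma stabilizability_output_nulling_le: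
  fixes A :: "real^'n^'n" and B :: "real^'m^'n" and C :: "real^'n^'p" and D :: "real^'m^'p"
  assumes ri: "right_invertible A B C D"
    and ss: "\<And>z. z \<in> minimum_phase_zeros td A B C D \<Longrightarrow>
          algebraic_multiplicity A B C D z = geometric_multiplicity A B C D z"
    and real: "minimum_phase_zeros td A B C D \<subseteq> \<real>"
    and V: "stabilizability_output_nulling td A B C D V"
  shows "V \<subseteq> stable_zero_span td A B C D"
proof
  fix v assume v: "v \<in> V"
  obtain F :: "real^'n^'m" where sub: "subspace V"
    and F: "\<And>v. v \<in> V \<Longrightarrow> (A + B ** F) *v v \<in> V" "\<And>v. v \<in> V \<Longrightarrow> (C + D ** F) *v v = 0"
    and spec: "spectrum_on (A + B ** F) V \<subseteq> stable_region td"
    using V unfolding stabilizability_output_nulling_def by blast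
  let ?N = "complex_matrix (A + B ** F)"
  define Z where "Z = complexification V"
  have Z: "z \<in> Z \<longleftrightarrow> re_vec z \<in> V \<and> im_vec z \<in> V" for z
    by (simp add: Z_def complexification_def re_vec_def im_vec_def)
  have scale: "re_vec (c *s z) = Re c *\<^sub>R re_vec z - Im c *\<^sub>R im_vec z"
    "im_vec (c *s z) = Re c *\<^sub>R im_vec z + Im c *\<^sub>R re_vec z" for c and z :: "complex^'n"
    by (simp_all add: vec_eq_iff re_vec_def im_vec_def)
  have subZ: "vec.subspace Z"
    unfolding vec.subspace_def Z scale
    by (auto simp: Z subspace_0[OF sub] subspace_add[OF sub] subspace_diff[OF sub]
        subspace_scale[OF sub])
  have inv: "?N *v z \<in> Z" if "z \<in> Z" for z
    using that F(1) by (simp add: Z re_vec_mult im_vec_mult)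
  have eig: "l \<in> stable_region td" if "z \<in> Z" "z \<noteq> 0" "?N *v z = l *s z" for z l
    using that spec unfolding spectrum_on_def Z_def by blast
  have null: "complex_matrix C *v z + complex_matrix D *v (complex_matrix F *v z) = 0" if "z \<in> Z" for z
    unfolding complex_matrix_closed_loop[symmetric]
    using that F(2)[of "re_vec z"] F(2)[of "im_vec z"]
    by (metis (no_types, lifting) Z complex_eq_iff im_vec_def im_vec_mult re_vec_def re_vec_mult
        vec_eq_iff vec_lambda_beta zero_index zero_complex.sel)
  have "cvec v \<in> Z" using v sub by (simp add: Z subspace_0)
  then have chain: "eigen_chain ?N (stable_region td) Z (cvec v)"
    using eigen_chain_all[of Z ?N "stable_region td"] inv subZ eig by blast
  have "a \<bullet> v = 0" if a: "\<And>w. w \<in> stable_zero_span td A B C D \<Longrightarrow> a \<bullet> w = 0" for a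
  proof -
    have "cdot a (cvec v) = 0"
      using eigen_chain_orthogonal[OF ri ss real a null chain] by blast
    then show ?thesis by (simp add: cdot_eq_0_iff)
  qed
  moreover obtain y w where yw: "y \<in> span (stable_zero_span td A B C D)"
      "\<And>u. u \<in> span (stable_zero_span td A B C D) \<Longrightarrow> orthogonal w u" "v = y + w"
    using orthogonal_subspace_decomp_exists[of "stable_zero_span td A B C D" v] by blast
  ultimately have "w \<bullet> v = 0" "w \<bullet> y = 0"
    using span_base by (auto simp: orthogonal_def)
  then have "w = 0" using yw(3) by (simp add: inner_add_right)
  then show "v \<in> stable_zero_span td A B C D"
    using yw by (simp add: stable_zero_span_def span_span)
qed

section \<open>Independent transversals of families of subspaces\<close>

text \<open>\<open>Z\<close> is any set inside both spans, because the union of a family over an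
  intersection of index sets may span less than the intersection of the two spans.\<close>

lemma dim_submodular:
  fixes X Y Z :: "'a::euclidean_space set"
  assumes "Z \<subseteq> span X" "Z \<subseteq> span Y"
  shows "dim (X \<union> Y) + dim Z \<le> dim X + dim Y"
proof -
  have "dim {x + y |x y. x \<in> span X \<and> y \<in> span Y} + dim (span X \<inter> span Y) = dim (span X) + dim (span Y)"
    by (rule dim_sums_Int) simp_all
  moreover have "dim Z \<le> dim (span X \<inter> span Y)" using assms by (intro dim_subset) blast
  moreover have "dim (X \<union> Y) = dim {x + y |x y. x \<in> span X \<and> y \<in> span Y}"
    unfolding span_Un[symmetric] by simp
  ultimately show ?thesis by simp
qed

text \<open>
  A deficiency version of Rado's theorem. If some set of indices is tight, the union \<open>T\<close> of all
  tight sets avoiding \<open>x\<close> is tight by submodularity, and a vector of \<open>U x\<close> outside its span can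
  be moved into \<open>V\<close>.
\<close>

lemma rado_deficiency:
  fixes U :: "'i \<Rightarrow> ('a::euclidean_space) set" and V :: "'a set"
  assumes "finite I" and "\<And>P. P \<subseteq> I \<Longrightarrow> card P + c \<le> dim (V \<union> \<Union> (U ` P))"
  shows "\<exists>Q v. Q \<subseteq> I \<and> (\<forall>x\<in>Q. v x \<in> U x) \<and> card I + c \<le> card Q + dim V \<and>
    dim (V \<union> v ` Q) = dim V + card Q"
  using assms
proof (induction I arbitrary: V c rule: finite_induct)
  case empty
  from empty[of "{}"] show ?case by (intro exI[of _ "{}"]) simp
next
  case (insert x I)
  let ?d = "\<lambda>P. dim (V \<union> \<Union> (U ` P))"
  have ge: "card P + c \<le> ?d P" if "P \<subseteq> insert x I" for P using insert.prems that by blast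
  show ?case
  proof (cases "\<forall>P\<subseteq>I. card P + Suc c \<le> ?d P")
    \<comment> \<open>Every inequality has slack, so \<open>x\<close> is left unselected and the
      induction hypothesis is used with \<open>Suc c\<close>, which keeps the total count.\<close>
    case True
    from insert.IH[of "Suc c" V] True obtain Q v where
      "Q \<subseteq> I" "\<forall>x\<in>Q. v x \<in> U x" "card I + Suc c \<le> card Q + dim V" "dim (V \<union> v ` Q) = dim V + card Q"
      by blast
    with insert.hyps show ?thesis by (intro exI[of _ Q] exI[of _ v]) auto
  next
    case False
    define tight where "tight P \<longleftrightarrow> P \<subseteq> I \<and> ?d P = card P + c" for P
    have nontight: "card P + Suc c \<le> ?d P" if "P \<subseteq> I" "\<not> tight P" for P
    proof -
      have "card P + c \<le> ?d P" using that by (intro ge) blast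
      then show ?thesis using that by (simp add: tight_def)
    qed
    obtain P0 where "tight P0" using False nontight by blast
    moreover have "card P < Suc (card I)" if "tight P" for P
      using that insert.hyps(1) by (simp add: tight_def card_mono less_Suc_eq_le)
    ultimately obtain T where T: "tight T" and T_max: "\<And>P. tight P \<Longrightarrow> card P \<le> card T"
      using ex_has_greatest_nat[of tight P0 card "Suc (card I)"] by blast
    have fin: "finite P" if "P \<subseteq> I" for P using that insert.hyps(1) finite_subset by blast
    have T_all: "P \<subseteq> T" if P: "tight P" for P
    proof -
      have sub: "P \<subseteq> I" "T \<subseteq> I" using P T by (auto simp: tight_def)
      have "?d (P \<union> T) + ?d (P \<inter> T) \<le> ?d P + ?d T"
      proof -
        have "V \<union> \<Union> (U ` (P \<inter> T)) \<subseteq> span (V \<union> \<Union> (U ` P))"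
          "V \<union> \<Union> (U ` (P \<inter> T)) \<subseteq> span (V \<union> \<Union> (U ` T))"
          by (rule order_trans[OF _ span_superset], blast)+
        from dim_submodular[OF this]
        show ?thesis by (simp add: Un_ac image_Un)
      qed
      moreover have "card (P \<inter> T) + c \<le> ?d (P \<inter> T)" "card (P \<union> T) + c \<le> ?d (P \<union> T)"
        using sub by (intro ge; blast)+
      moreover have "card (P \<union> T) + card (P \<inter> T) = card P + card T"
        using card_Un_Int[of P T] fin sub by simp
      ultimately have "tight (P \<union> T)"
        using P T sub by (simp add: tight_def)
      then have "card (P \<union> T) \<le> card T" by (rule T_max)
      then show ?thesis using fin[of "P \<union> T"] sub
        by (metis Un_least Un_upper1 Un_upper2 card_seteq)
    qed
    have "T \<subseteq> I" using T by (simp add: tight_def)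
    have "x \<notin> T" using \<open>T \<subseteq> I\<close> insert.hyps by blast
    \<comment> \<open>Otherwise adding \<open>x\<close> to the tight set would raise its cardinality
      but not its dimension, against \<open>ge\<close>.\<close>
    have "\<exists>u\<in>U x. u \<notin> span (V \<union> \<Union> (U ` T))"
    proof (rule ccontr)
      assume "\<not> ?thesis"
      then have "V \<union> \<Union> (U ` insert x T) \<subseteq> span (V \<union> \<Union> (U ` T))"
        using span_superset[of "V \<union> \<Union> (U ` T)"] by auto
      then have "?d (insert x T) \<le> ?d T" by (metis dim_span dim_subset)
      moreover have "card (insert x T) + c \<le> ?d (insert x T)"
        using \<open>T \<subseteq> I\<close> by (intro ge) blast
      ultimately show False
        using T fin[OF \<open>T \<subseteq> I\<close>] \<open>x \<notin> T\<close> by (simp add: tight_def)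
    qed
    then obtain u where u: "u \<in> U x" "u \<notin> span (V \<union> \<Union> (U ` T))" by blast
    have uV: "u \<notin> span V" using u(2) span_mono[of V "V \<union> \<Union> (U ` T)"] by blast
    \<comment> \<open>Every tight set lies in \<open>T\<close>, so \<open>u\<close> is new to it and
      raises its dimension; the other sets already have slack one.\<close>
    have "card P + Suc c \<le> dim (insert u V \<union> \<Union> (U ` P))" if P: "P \<subseteq> I" for P
    proof (cases "tight P")
      case True
      then have "u \<notin> span (V \<union> \<Union> (U ` P))"
        using u(2) T_all[OF True] span_mono[of "V \<union> \<Union> (U ` P)" "V \<union> \<Union> (U ` T)"] by blast
      then show ?thesis using True by (simp add: dim_insert tight_def)
    next
      case False
      have "V \<union> \<Union> (U ` P) \<subseteq> insert u V \<union> \<Union> (U ` P)" by blast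
      from dim_subset[OF this] nontight[OF P False] show ?thesis by linarith
    qed
    from insert.IH[OF this] obtain Q v where Q: "Q \<subseteq> I" "\<forall>x\<in>Q. v x \<in> U x"
      "card I + Suc c \<le> card Q + dim (insert u V)"
      "dim (insert u V \<union> v ` Q) = dim (insert u V) + card Q" by blast
    have "x \<notin> Q" using Q(1) insert.hyps by blast
    have img: "(v(x := u)) ` insert x Q = insert u (v ` Q)" using \<open>x \<notin> Q\<close> by auto
    have "card (insert x Q) = Suc (card Q)" using \<open>x \<notin> Q\<close> fin[OF Q(1)] by simp
    then show ?thesis
      using Q u \<open>x \<notin> Q\<close> uV insert.hyps
      by (intro exI[of _ "insert x Q"] exI[of _ "v(x := u)"]) (auto simp only: img, auto simp: dim_insert)
  qed
qed

section \<open>From sums of subspaces and sub-multisets to spans and index maps\<close>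

lemma set_plus_sum_span:
  fixes U :: "'i \<Rightarrow> ('a::real_vector) set"
  assumes "finite P" "subspace V" "\<And>x. x \<in> P \<Longrightarrow> subspace (U x)"
  shows "V + sum U P = span (V \<union> \<Union> (U ` P))"
  using assms(1,3)
proof (induction P rule: finite_induct)
  case empty
  have "V + sum U {} = V" "span (V \<union> \<Union> (U ` {})) = span V" by simp_all
  then show ?case using assms(2) span_eq_iff[of V] by metis
next
  case (insert x P)
  have "V + sum U (insert x P) = U x + (V + sum U P)"
    using insert.hyps by (simp add: add.left_commute)
  also have "\<dots> = U x + span (V \<union> \<Union> (U ` P))" using insert by simp
  also have "\<dots> = span (U x \<union> (V \<union> \<Union> (U ` P)))"
    using insert.prems unfolding span_Un
    by (auto simp: set_plus_def span_eq_iff[THEN iffD2])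
  finally show ?case by (simp add: Un_ac)
qed

text \<open>Multiplicities become injectivity: equal eigenvalues are matched with distinct indices,
  so modes can be counted through the index set.\<close>

lemma image_mset_subset_inj:
  assumes "finite A" "finite B" "image_mset f (mset_set A) \<subseteq># image_mset g (mset_set B)"
  shows "\<exists>h. inj_on h A \<and> h ` A \<subseteq> B \<and> (\<forall>x\<in>A. g (h x) = f x)"
  using assms
proof (induction A arbitrary: B rule: finite_induct)
  case empty
  show ?case by simp
next
  case (insert x A)
  then have sub: "add_mset (f x) (image_mset f (mset_set A)) \<subseteq># image_mset g (mset_set B)" by simp
  then have "f x \<in># image_mset g (mset_set B)" by (meson mset_subset_eqD union_single_eq_member)
  then obtain y where y: "y \<in> B" "g y = f x" using insert.prems(1) by auto
  then have "mset_set B = add_mset y (mset_set (B - {y}))"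
    using insert.prems(1) by (simp add: mset_set.remove)
  then have "image_mset f (mset_set A) \<subseteq># image_mset g (mset_set (B - {y}))"
    using sub y by simp
  with insert.IH[of "B - {y}"] insert.prems(1) obtain h where
    h: "inj_on h A" "h ` A \<subseteq> B - {y}" "\<forall>x\<in>A. g (h x) = f x" by auto
  let ?h = "h(x := y)"
  have "?h ` insert x A = insert y (h ` A)" using insert.hyps(2) by auto
  then have "?h ` insert x A \<subseteq> B" using h(2) y(1) by auto
  moreover have "inj_on ?h (insert x A)"
    using h(1,2) insert.hyps(2) by (auto simp: inj_on_def)
  moreover have "\<forall>z\<in>insert x A. g (?h z) = f z" using h(3) y(2) insert.hyps(2) by auto
  ultimately show ?case by blast
qed

section \<open>Matrices with a real eigenbasis\<close>

lemma representation_eigen: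
  fixes M :: "real^'n^'n"
  assumes ind: "independent E" and eig: "\<And>b. b \<in> E \<Longrightarrow> M *v b = \<mu> b *\<^sub>R b"
    and v: "v \<in> span E"
  shows "M *v v \<in> span E" "representation E (M *v v) b = \<mu> b * representation E v b"
proof -
  have fin: "finite E" using ind by (rule independent_imp_finite)
  have exp: "v = (\<Sum>e\<in>E. representation E v e *\<^sub>R e)"
    using sum_representation_eq[OF ind v fin] by simp
  have "M *v v = (\<Sum>e\<in>E. M *v (representation E v e *\<^sub>R e))"
    using arg_cong[OF exp, of "(*v) M"] linear_sum[OF matrix_vector_mul_linear, of M] by metis
  also have "\<dots> = (\<Sum>e\<in>E. (\<mu> e * representation E v e) *\<^sub>R e)"
    by (intro sum.cong) (simp_all add: eig mult.commute matrix_vector_mult_scaleR)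
  finally have Mv: "M *v v = (\<Sum>e\<in>E. (\<mu> e * representation E v e) *\<^sub>R e)" .
  then show "M *v v \<in> span E"
    by (simp add: span_sum span_scale span_base)
  show "representation E (M *v v) b = \<mu> b * representation E v b"
  proof (cases "b \<in> E")
    case True
    have "representation E (M *v v) b
        = (\<Sum>e\<in>E. representation E ((\<mu> e * representation E v e) *\<^sub>R e) b)"
      unfolding Mv using ind by (subst representation_sum) (auto simp: span_scale span_base)
    also have "\<dots> = (\<Sum>e\<in>E. if e = b then \<mu> b * representation E v b else 0)"
      using ind by (intro sum.cong) (auto simp: representation_scale representation_basis span_base)
    also have "\<dots> = \<mu> b * representation E v b" using True fin by simp
    finally show ?thesis .
  next
    case False
    then have "representation E x b = 0" for x using representation_ne_zero by metis
    then show ?thesis by simp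
  qed
qed

text \<open>Comparing coordinates gives, for each basis vector, a real two-by-two system for the
  real and imaginary coordinates with determinant
  \<open>(\<mu> b - Re s)\<^sup>2 + (Im s)\<^sup>2\<close>. Some coordinate pair is nonzero, so a
  determinant vanishes. \<open>E\<close> may span a proper subspace, which covers restricted spectra
  as well.\<close>

lemma eigenbasis_spectrum:
  fixes M :: "real^'n^'n"
  assumes ind: "independent E" and eig: "\<And>b. b \<in> E \<Longrightarrow> M *v b = \<mu> b *\<^sub>R b"
    and z: "re_vec z \<in> span E" "im_vec z \<in> span E" "z \<noteq> 0" "complex_matrix M *v z = s *s z"
  shows "\<exists>b\<in>E. s = complex_of_real (\<mu> b)"
proof -
  let ?r = "representation E (re_vec z)" and ?i = "representation E (im_vec z)"
  have scale: "re_vec (s *s z) = Re s *\<^sub>R re_vec z - Im s *\<^sub>R im_vec z"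
    "im_vec (s *s z) = Re s *\<^sub>R im_vec z + Im s *\<^sub>R re_vec z"
    by (simp_all add: vec_eq_iff re_vec_def im_vec_def)
  have re: "M *v re_vec z = Re s *\<^sub>R re_vec z - Im s *\<^sub>R im_vec z"
    and im: "M *v im_vec z = Re s *\<^sub>R im_vec z + Im s *\<^sub>R re_vec z"
    using arg_cong[OF z(4), of re_vec] arg_cong[OF z(4), of im_vec]
    by (simp_all only: re_vec_mult im_vec_mult scale)
  have cr: "\<mu> b * ?r b = Re s * ?r b - Im s * ?i b" for b
    using representation_eigen(2)[OF ind eig z(1), of b] ind z
    by (simp add: re representation_diff representation_scale span_scale)
  have ci: "\<mu> b * ?i b = Re s * ?i b + Im s * ?r b" for b
    using representation_eigen(2)[OF ind eig z(2), of b] ind z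
    by (simp add: im representation_add representation_scale span_scale)
  have "re_vec z \<noteq> 0 \<or> im_vec z \<noteq> 0"
    using z(3) by (auto simp: vec_eq_iff re_vec_def im_vec_def complex_eq_iff)
  then have "\<exists>b\<in>E. ?r b \<noteq> 0 \<or> ?i b \<noteq> 0"
    using sum_nonzero_representation_eq[OF ind z(1)] sum_nonzero_representation_eq[OF ind z(2)]
      representation_ne_zero
    by (metis (mono_tags, lifting) mem_Collect_eq scaleR_eq_0_iff sum.neutral)
  then obtain b where b: "b \<in> E" "?r b \<noteq> 0 \<or> ?i b \<noteq> 0" by blast
  have "((\<mu> b - Re s)\<^sup>2 + (Im s)\<^sup>2) * ?r b = 0" "((\<mu> b - Re s)\<^sup>2 + (Im s)\<^sup>2) * ?i b = 0"
    using cr[of b] ci[of b] by algebra+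
  then have "(\<mu> b - Re s)\<^sup>2 + (Im s)\<^sup>2 = 0" using b(2) by auto
  then have "\<mu> b = Re s" "Im s = 0" by (simp_all add: sum_power2_eq_zero_iff)
  then show ?thesis using b(1) by (metis complex_eq_iff Re_complex_of_real Im_complex_of_real)
qed

lemma feedback_exists:
  fixes w :: "real^'n \<Rightarrow> real^'m"
  assumes "independent E"
  shows "\<exists>F :: real^'n^'m. \<forall>b\<in>E. F *v b = w b"
proof -
  obtain g where "linear g" "\<forall>b\<in>E. g b = w b"
    using linear_independent_extend[OF assms] by blast
  then have "matrix g *v b = w b" if "b \<in> E" for b using that by (simp add: matrix_works)
  then show ?thesis by blast
qed

lemma closed_loop_mult: "(M + N ** F) *v x = M *v x + N *v (F *v x)"
  for M :: "real^'n^'k"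
  by (simp add: matrix_vector_mult_add_rdistrib matrix_vector_mul_assoc)

text \<open>The basis is chosen among the spanning zero directions, so every member keeps a
  frequency and an input of its own.\<close>

lemma stable_zero_span_basis:
  fixes A :: "real^'n^'n" and B :: "real^'m^'n" and C :: "real^'n^'p" and D :: "real^'m^'p"
  shows "\<exists>E \<mu> w. independent E \<and> span E = stable_zero_span td A B C D \<and>
    (\<forall>b\<in>E. complex_of_real (\<mu> b) \<in> stable_region td \<and> A *v b + B *v w b = \<mu> b *\<^sub>R b \<and>
      C *v b + D *v w b = 0)"
proof -
  let ?Z = "\<Union>s\<in>{s. complex_of_real s \<in> stable_region td}. zero_directions A B C D s"
  obtain E where E: "E \<subseteq> ?Z" "independent E" "?Z \<subseteq> span E"
    by (rule maximal_independent_subset)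
  have "\<forall>b\<in>E. \<exists>s w. complex_of_real s \<in> stable_region td \<and> A *v b + B *v w = s *\<^sub>R b \<and> C *v b + D *v w = 0"
    using E(1) by (fastforce simp: zero_directions_def)
  then obtain \<mu> w where "\<forall>b\<in>E. complex_of_real (\<mu> b) \<in> stable_region td \<and>
      A *v b + B *v w b = \<mu> b *\<^sub>R b \<and> C *v b + D *v w b = 0" by metis
  moreover have "span E = stable_zero_span td A B C D"
    unfolding stable_zero_span_def using E by (intro antisym span_mono span_minimal) auto
  ultimately show ?thesis using E(2) by blast
qed

text \<open>The feedback that sends each basis vector to its own input makes the restriction
  diagonal with real stable eigenvalues and annihilates the output.\<close>

lemma stable_zero_span_stabilizability_output_nulling:
  fixes A :: "real^'n^'n" and B :: "real^'m^'n" and C :: "real^'n^'p" and D :: "real^'m^'p"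
  shows "stabilizability_output_nulling td A B C D (stable_zero_span td A B C D)"
proof -
  let ?S = "stable_zero_span td A B C D"
  obtain E \<mu> w where E: "independent E" "span E = ?S"
    and st: "\<And>b. b \<in> E \<Longrightarrow> complex_of_real (\<mu> b) \<in> stable_region td"
    and eq: "\<And>b. b \<in> E \<Longrightarrow> A *v b + B *v w b = \<mu> b *\<^sub>R b"
      "\<And>b. b \<in> E \<Longrightarrow> C *v b + D *v w b = 0"
    using stable_zero_span_basis[of td A B C D] by blast
  obtain F :: "real^'n^'m" where F: "\<And>b. b \<in> E \<Longrightarrow> F *v b = w b"
    using feedback_exists[OF E(1), of w] by blast
  have eig: "(A + B ** F) *v b = \<mu> b *\<^sub>R b" if "b \<in> E" for b
    using that F eq by (simp add: closed_loop_mult)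
  have null: "(C + D ** F) *v v = 0" if "v \<in> span E" for v
    using that
  proof (induction rule: span_induct_alt)
    case (step c x y)
    then show ?case using F eq(2)
      by (simp add: closed_loop_mult matrix_vector_right_distrib matrix_vector_mult_scaleR
          flip: scaleR_add_right add.assoc)
  qed simp
  have "spectrum_on (A + B ** F) ?S \<subseteq> stable_region td"
    using eigenbasis_spectrum[OF E(1) eig] st
    unfolding spectrum_on_def complexification_def E(2)[symmetric] re_vec_def im_vec_def by blast
  then show ?thesis
    unfolding stabilizability_output_nulling_def
    using representation_eigen(1)[OF E(1) eig] null
    by (metis E(2) subspace_span)
qed

text \<open>\<open>GREATEST\<close> yields information only once a greatest element is exhibited:
  the span is admissible and contains every admissible subspace.\<close>

lemma Vg_star_eq:
  fixes A :: "real^'n^'n" and B :: "real^'m^'n" and C :: "real^'n^'p" and D :: "real^'m^'p"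
  assumes ri: "right_invertible A B C D"
    and ss: "\<And>z. z \<in> minimum_phase_zeros td A B C D \<Longrightarrow>
          algebraic_multiplicity A B C D z = geometric_multiplicity A B C D z"
    and real: "minimum_phase_zeros td A B C D \<subseteq> \<real>"
  shows "Vg_star td A B C D = stable_zero_span td A B C D"
  unfolding Vg_star_def
proof (rule Greatest_equality)
  show "stabilizability_output_nulling td A B C D (stable_zero_span td A B C D)"
    by (rule stable_zero_span_stabilizability_output_nulling)
  show "V \<subseteq> stable_zero_span td A B C D" if "stabilizability_output_nulling td A B C D V" for V
    using stabilizability_output_nulling_le[OF ri ss real that] .
qed

section \<open>Static gain and tracking\<close>

lemma dc_point_of_real: "complex_of_real (dc_point td) = dc_point td"
  by (cases td) simp_all

lemma dc_point_unstable: "dc_point td \<notin> stable_region td"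
  by (cases td) simp_all

lemma matrix_inv_inverse:
  assumes "invertible M"
  shows "M ** matrix_inv M = mat 1 \<and> matrix_inv M ** M = mat 1"
  using assms unfolding invertible_def matrix_inv_def by (rule someI_ex)

lemma dc_resolvent_invertible:
  fixes M :: "real^'n^'n"
  assumes "matrix_spectrum M \<subseteq> stable_region td"
  shows "invertible (mat (dc_point td) - M)"
proof -
  have "v = 0" if "(mat (dc_point td) - M) *v v = 0" for v
  proof (rule ccontr)
    assume "v \<noteq> 0"
    have "M *v v = dc_point td *\<^sub>R v"
      using that by (simp add: matrix_vector_mult_diff_rdistrib mat_vector_mult)
    then have "complex_matrix M *v cvec v = dc_point td *s cvec v"
      by (simp add: complex_matrix_cvec flip: dc_point_of_real)
        (simp add: cvec_def vec_eq_iff)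
    moreover have "cvec v \<noteq> 0" using \<open>v \<noteq> 0\<close> by (simp add: cvec_def vec_eq_iff)
    ultimately have "dc_point td \<in> matrix_spectrum M" unfolding matrix_spectrum_def by blast
    then show False using assms dc_point_unstable by blast
  qed
  then show ?thesis
    by (simp add: invertible_left_inverse matrix_left_invertible_ker)
qed

text \<open>The constant frequency is no zero, so the pencil there is onto and reaches state
  residual 0 with any output \<open>y\<close>. Real parts of the complex solution suffice, since all
  data are real.\<close>

lemma static_gain_right_inverse:
  fixes A :: "real^'n^'n" and B :: "real^'m^'n" and C :: "real^'n^'p" and D :: "real^'m^'p"
    and F :: "real^'n^'m"
  assumes ri: "right_invertible A B C D" and dc: "dc_point td \<notin> invariant_zeros A B C D"
    and spec: "matrix_spectrum (A + B ** F) \<subseteq> stable_region td"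
  obtains G :: "real^'p^'m" where "static_gain td A B C D F ** G = mat 1"
proof -
  let ?M = "mat (dc_point td) - (A + B ** F)"
  let ?K = "static_gain td A B C D F"
  have inv: "matrix_inv ?M ** ?M = mat 1"
    using dc_resolvent_invertible[OF spec] matrix_inv_inverse by blast
  have "rank (system_matrix A B C D (dc_point td)) = CARD('n + 'p)"
    using dc rank_le_rows[of "system_matrix A B C D (dc_point td)"]
      normal_rank_right_invertible(1)[OF ri]
    by (simp add: invariant_zeros_def)
  then have surj: "surj ((*v) (system_matrix A B C D (dc_point td)))"
    by (rule full_row_rank_surj)
  have "\<exists>u. y = ?K *v u" for y
  proof -
    let ?e = "(\<chi> k. case k of Inl i \<Rightarrow> 0 | Inr l \<Rightarrow> complex_of_real (y $ l)) :: complex^('n + 'p)"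
    obtain xu where xu: "?e = system_matrix A B C D (dc_point td) *v xu"
      using surj by (metis surjD)
    define x u where "x = (\<chi> j. xu $ Inl j)" and "u = (\<chi> j. xu $ Inr j)"
    have "complex_matrix A *v x - complex_of_real (dc_point td) *s x + complex_matrix B *v u = 0"
      unfolding vec_eq_iff x_def u_def dc_point_of_real system_matrix_mult(1)[of A B C D, symmetric]
        xu[symmetric] by simp
    from arg_cong[OF this, of re_vec]
    have st: "A *v re_vec x - dc_point td *\<^sub>R re_vec x + B *v re_vec u = 0"
      by (simp add: re_vec_mult)
    have "complex_matrix C *v x + complex_matrix D *v u = cvec y"
      unfolding vec_eq_iff x_def u_def system_matrix_mult(2)[of A B C D "dc_point td", symmetric]
        xu[symmetric] by (simp add: cvec_def)
    from arg_cong[OF this, of re_vec]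
    have out: "C *v re_vec x + D *v re_vec u = y" by (simp add: re_vec_mult)
    \<comment> \<open>The external input that remains once the feedback part is removed from
      \<open>u\<close>.\<close>
    let ?w = "re_vec u - F *v re_vec x"
    have "?M *v re_vec x = B *v ?w"
      using st by (simp add: closed_loop_mult matrix_vector_mult_diff_rdistrib mat_vector_mult
          matrix_vector_mult_diff_distrib algebra_simps flip: matrix_vector_mul_assoc)
    then have "matrix_inv ?M *v (B *v ?w) = re_vec x"
      using inv by (metis matrix_vector_mul_assoc matrix_vector_mul_lid)
    then have "?K *v ?w = (C + D ** F) *v re_vec x + D *v ?w"
      by (simp add: static_gain_def matrix_vector_mult_add_rdistrib flip: matrix_vector_mul_assoc)
    also have "\<dots> = y"
      using out by (simp add: closed_loop_mult matrix_vector_mult_diff_distrib)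
    finally show ?thesis by metis
  qed
  then have "surj ((*v) ?K)" by (auto simp: surj_def)
  then show ?thesis using that matrix_right_invertible_surjective by blast
qed

text \<open>The integrating factor is applied on the half-line only, because the derivative at 0 is
  one-sided.\<close>

lemma linear_ode_decay:
  fixes g :: "real \<Rightarrow> real"
  assumes "\<And>t. t \<ge> 0 \<Longrightarrow> (g has_real_derivative \<mu> * g t) (at t within {0..})" and "\<mu> < 0"
  shows "(g \<longlongrightarrow> 0) at_top"
proof -
  have "((\<lambda>t. exp (- \<mu> * t) * g t) has_field_derivative 0) (at t within {0..})" if "t \<in> {0..}" for t
    using that by (auto intro!: derivative_eq_intros assms(1))
  then obtain c where c: "\<And>t. t \<in> {0..} \<Longrightarrow> exp (- \<mu> * t) * g t = c"
    using has_field_derivative_zero_constant[of "{0..}" "\<lambda>t. exp (- \<mu> * t) * g t"] by auto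
  have g: "g t = c * exp (\<mu> * t)" if "t \<ge> 0" for t
    using c[of t] that by (auto simp: exp_minus field_simps)
  have "eventually (\<lambda>t. c * exp (\<mu> * t) = g t) at_top"
    using eventually_ge_at_top[of "0 :: real"] by eventually_elim (simp add: g)
  moreover have "((\<lambda>t. c * exp (\<mu> * t)) \<longlongrightarrow> 0) at_top"
    by (intro tendsto_mult_right_zero filterlim_compose[OF exp_at_bot]
        filterlim_tendsto_neg_mult_at_bot[OF tendsto_const assms(2) filterlim_ident])
  ultimately show ?thesis by (rule Lim_transform_eventually[rotated])
qed

text \<open>Deviations from the equilibrium \<open>xe r\<close> split into decaying scalar modes
  along the eigenbasis, and the right inverse \<open>G\<close> makes the output at the equilibrium
  equal to \<open>r\<close>.\<close>

lemma eigenbasis_tracking: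
  fixes A :: "real^'n^'n" and B :: "real^'m^'n" and C :: "real^'n^'p" and D :: "real^'m^'p"
    and F :: "real^'n^'m"
  assumes E: "independent E" "span E = UNIV"
    and eig: "\<And>b. b \<in> E \<Longrightarrow> (A + B ** F) *v b = \<mu> b *\<^sub>R b"
    and st: "\<And>b. b \<in> E \<Longrightarrow> complex_of_real (\<mu> b) \<in> stable_region td"
    and inv: "invertible (mat (dc_point td) - (A + B ** F))"
    and G: "static_gain td A B C D F ** G = mat 1"
  shows "tracks_constants td A B C D F G"
proof -
  let ?M = "A + B ** F"
  let ?R = "mat (dc_point td) - ?M"
  define xe where "xe r = matrix_inv ?R *v (B *v (G *v r))" for r
  have "?R *v xe r = B *v (G *v r)" for r
    unfolding xe_def using inv by (metis matrix_inv_inverse matrix_vector_mul_assoc matrix_vector_mul_lid)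
  then have steady: "?M *v xe r + B *v (G *v r) = dc_point td *\<^sub>R xe r" for r
    by (simp add: matrix_vector_mult_diff_rdistrib mat_vector_mult algebra_simps)
  have out: "C *v xe r + D *v (F *v xe r + G *v r) = r" for r
  proof -
    have "C *v xe r + D *v (F *v xe r + G *v r) = (C + D ** F) *v xe r + D *v (G *v r)"
      by (simp add: closed_loop_mult matrix_vector_right_distrib)
    also have "\<dots> = (static_gain td A B C D F ** G) *v r"
      by (simp add: static_gain_def xe_def matrix_vector_mult_add_rdistrib flip: matrix_vector_mul_assoc)
    finally show ?thesis by (simp add: G)
  qed
  have limit: "((\<lambda>t. C *v x t + D *v (F *v x t + G *v r)) \<longlongrightarrow> r) net"
    if "\<And>b. b \<in> E \<Longrightarrow> ((\<lambda>t. representation E (x t - xe r) b) \<longlongrightarrow> 0) net" for x r and net :: "'t filter"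
  proof -
    have fin: "finite E" using E(1) by (rule independent_imp_finite)
    have "((\<lambda>t. \<Sum>b\<in>E. representation E (x t - xe r) b *\<^sub>R b) \<longlongrightarrow> (\<Sum>b\<in>E. 0 *\<^sub>R b)) net"
      using that by (intro tendsto_sum tendsto_scaleR tendsto_const)
    then have "((\<lambda>t. x t - xe r) \<longlongrightarrow> 0) net"
      using E fin by (simp add: sum_representation_eq)
    then have x: "(x \<longlongrightarrow> xe r) net" by (simp add: LIM_zero_iff)
    have "((\<lambda>t. C *v x t + D *v (F *v x t + G *v r)) \<longlongrightarrow> C *v xe r + D *v (F *v xe r + G *v r)) net"
      by (intro tendsto_add bounded_linear.tendsto[OF matrix_vector_mul_bounded_linear] x tendsto_const)
    then show ?thesis by (simp add: out)
  qed
  have blin: "bounded_linear (\<lambda>v. representation E v b)" for b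
    unfolding linear_conv_bounded_linear[symmetric]
    by (rule linearI) (simp_all add: representation_add representation_scale E)
  have rep: "representation E (?M *v v) b = \<mu> b * representation E v b" for v b
    using representation_eigen(2)[OF E(1) eig] E(2) by blast
  have loop: "A *v x + B *v (F *v x + G *v r) = ?M *v (x - xe r) + dc_point td *\<^sub>R xe r" for x r
  proof -
    have "A *v x + B *v (F *v x + G *v r) = ?M *v x + B *v (G *v r)"
      by (simp add: closed_loop_mult matrix_vector_right_distrib)
    then show ?thesis
      by (simp only: steady[symmetric] matrix_vector_mult_diff_distrib) simp
  qed
  show ?thesis
  proof (cases td)
    case Continuous
    have "((\<lambda>t. C *v x t + D *v (F *v x t + G *v r)) \<longlongrightarrow> r) at_top"
      if x: "\<forall>t\<ge>0. (x has_vector_derivative (A *v x t + B *v (F *v x t + G *v r))) (at t within {0..})"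
      for r x
    proof (rule limit)
      fix b assume b: "b \<in> E"
      show "((\<lambda>t. representation E (x t - xe r) b) \<longlongrightarrow> 0) at_top"
      proof (rule linear_ode_decay)
        show "\<mu> b < 0" using st[OF b] Continuous by simp
        fix t :: real assume "t \<ge> 0"
        then have "((\<lambda>t. x t - xe r) has_vector_derivative ?M *v (x t - xe r)) (at t within {0..})"
          using x Continuous by (auto intro!: derivative_eq_intros simp: loop)
        from bounded_linear.has_vector_derivative[OF blin this, of b]
        show "((\<lambda>t. representation E (x t - xe r) b) has_real_derivative
            \<mu> b * representation E (x t - xe r) b) (at t within {0..})"
          by (simp add: rep has_real_derivative_iff_has_vector_derivative)
      qed
    qed
    then show ?thesis using Continuous by simp
  next
    case Discrete
    have "(\<lambda>t. C *v x t + D *v (F *v x t + G *v r)) \<longlonglongrightarrow> r"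
      if x: "\<forall>t. x (Suc t) = A *v x t + B *v (F *v x t + G *v r)" for r and x :: "nat \<Rightarrow> real^'n"
    proof (rule limit)
      fix b assume b: "b \<in> E"
      have "x (Suc t) - xe r = ?M *v (x t - xe r)" for t
        using x Discrete by (simp add: loop)
      then have "representation E (x t - xe r) b = representation E (x 0 - xe r) b * \<mu> b ^ t" for t
        by (induction t) (simp_all add: rep)
      then have eq: "(\<lambda>t. representation E (x t - xe r) b) = (\<lambda>t. representation E (x 0 - xe r) b * \<mu> b ^ t)"
        by blast
      have "(\<lambda>t. representation E (x 0 - xe r) b * \<mu> b ^ t) \<longlonglongrightarrow> 0"
        using st[OF b] Discrete by (intro tendsto_mult_right_zero LIMSEQ_power_zero) simp
      then show "(\<lambda>t. representation E (x t - xe r) b) \<longlonglongrightarrow> 0" unfolding eq .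
    qed
    then show ?thesis using Discrete by simp
  qed
qed

section \<open>Solvability\<close>

lemma R_sub_subspace: "subspace (R_sub A B C D i s)"
proof (rule subspaceI)
  show "0 \<in> R_sub A B C D i s"
    unfolding R_sub_def mem_Collect_eq by (rule exI[of _ 0]) simp
next
  fix x y assume "x \<in> R_sub A B C D i s" "y \<in> R_sub A B C D i s"
  then obtain w z where
    w: "(A - mat s) *v x + B *v w = 0" "\<forall>k. k \<noteq> i \<longrightarrow> (C *v x + D *v w) $ k = 0" and
    z: "(A - mat s) *v y + B *v z = 0" "\<forall>k. k \<noteq> i \<longrightarrow> (C *v y + D *v z) $ k = 0"
    unfolding R_sub_def by blast
  have "(A - mat s) *v (x + y) + B *v (w + z)
      = ((A - mat s) *v x + B *v w) + ((A - mat s) *v y + B *v z)"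
    "C *v (x + y) + D *v (w + z) = (C *v x + D *v w) + (C *v y + D *v z)"
    by (simp_all add: matrix_vector_right_distrib)
  then show "x + y \<in> R_sub A B C D i s"
    unfolding R_sub_def mem_Collect_eq using w z by (intro exI[of _ "w + z"]) simp
next
  fix c x assume "x \<in> R_sub A B C D i s"
  then obtain w where
    w: "(A - mat s) *v x + B *v w = 0" "\<forall>k. k \<noteq> i \<longrightarrow> (C *v x + D *v w) $ k = 0"
    unfolding R_sub_def by blast
  have "(A - mat s) *v (c *\<^sub>R x) + B *v (c *\<^sub>R w) = c *\<^sub>R ((A - mat s) *v x + B *v w)"
    "C *v (c *\<^sub>R x) + D *v (c *\<^sub>R w) = c *\<^sub>R (C *v x + D *v w)"
    by (simp_all add: matrix_vector_mult_scaleR scaleR_add_right)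
  then show "c *\<^sub>R x \<in> R_sub A B C D i s"
    unfolding R_sub_def mem_Collect_eq using w by (intro exI[of _ "c *\<^sub>R w"]) simp
qed

text \<open>The coefficient \<beta> may be 0: the zero directions at \<open>s\<close> belong to
  every \<open>R_sub\<close> at \<open>s\<close>. Nonzero output of selected modes thus needs an
  argument of its own.\<close>

lemma R_sub_iff:
  "v \<in> R_sub A B C D i s \<longleftrightarrow> (\<exists>w \<beta>. A *v v + B *v w = s *\<^sub>R v \<and> C *v v + D *v w = \<beta> *\<^sub>R axis i 1)"
proof -
  have out: "(\<forall>k. k \<noteq> i \<longrightarrow> y $ k = 0) \<longleftrightarrow> (\<exists>\<beta>. y = \<beta> *\<^sub>R axis i 1)" for y :: "real^'c"
    by (auto simp: vec_eq_iff axis_def)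
  have state: "(A - mat s) *v v + B *v w = 0 \<longleftrightarrow> A *v v + B *v w = s *\<^sub>R v" for w
    by (simp add: matrix_vector_mult_diff_rdistrib mat_vector_mult algebra_simps)
  show ?thesis unfolding R_sub_def mem_Collect_eq out state by blast
qed

lemma stable_zero_span_plus_R_sub:
  "finite P \<Longrightarrow> stable_zero_span td A B C D + (\<Sum>(i, j)\<in>P. R_sub A B C D i (ev i j))
    = span (stable_zero_span td A B C D \<union> (\<Union>(i, j)\<in>P. R_sub A B C D i (ev i j)))"
  by (rule set_plus_sum_span) (auto simp: stable_zero_span_def R_sub_subspace)

text \<open>The observable modes occupy distinct indices of the assigned family. Those hitting
  \<open>P\<close>, together with all unobservable modes, give independent vectors in the sum, and
  inclusion-exclusion bounds their number from below. Adding the sum of the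
  \<open>\<nu>bar i\<close> on the left avoids truncated subtraction.\<close>

lemma solvable_imp_dim_ge:
  fixes A :: "real^'n^'n" and B :: "real^'m^'n" and C :: "real^'n^'p" and D :: "real^'m^'p"
  assumes ri: "right_invertible A B C D"
    and ss: "\<And>z. z \<in> minimum_phase_zeros td A B C D \<Longrightarrow>
          algebraic_multiplicity A B C D z = geometric_multiplicity A B C D z"
    and real: "minimum_phase_zeros td A B C D \<subseteq> \<real>"
    and sol: "problem_3B_solvable td A B C D \<nu>bar ev"
    and P: "P \<subseteq> (SIGMA i:UNIV. {1..\<nu>bar i})"
  shows "dim (stable_zero_span td A B C D + (\<Sum>(i, j)\<in>P. R_sub A B C D i (ev i j)))
     + (\<Sum>i\<in>UNIV. \<nu>bar i) \<ge> card P + CARD('n)"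
proof -
  obtain F :: "real^'n^'m" and \<nu> \<mu> v where
    spec: "matrix_spectrum (A + B ** F) \<subseteq> stable_region td"
    and dec: "state_to_output_decoupling A B C D F \<nu> \<mu> v"
    and le: "\<And>i. image_mset (\<mu> (Some i)) (mset_set {1..\<nu> (Some i)})
                  \<subseteq># image_mset (ev i) (mset_set {1..\<nu>bar i})"
    using sol unfolding problem_3B_solvable_def by blast
  define J where "J = (SIGMA k:UNIV. {1..\<nu> k})"
  define f where "f = (\<lambda>(k, j). v k j)"
  have inj: "inj_on f J" and ind: "independent (f ` J)" and sp: "span (f ` J) = UNIV"
    and eig: "\<And>k j. j \<in> {1..\<nu> k} \<Longrightarrow> (A + B ** F) *v v k j = \<mu> k j *\<^sub>R v k j"
    and null: "\<And>j. j \<in> {1..\<nu> None} \<Longrightarrow> (C + D ** F) *v v None j = 0"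
    and out: "\<And>i j. j \<in> {1..\<nu> (Some i)} \<Longrightarrow> \<exists>\<beta>. (C + D ** F) *v v (Some i) j = \<beta> *\<^sub>R axis i 1"
    using dec unfolding state_to_output_decoupling_def Let_def J_def f_def by blast+
  let ?I = "SIGMA i:UNIV. {1..\<nu>bar i}"
  let ?J1 = "SIGMA i:UNIV. {1..\<nu> (Some i)}"
  let ?S = "stable_zero_span td A B C D"
  let ?W = "span (?S \<union> (\<Union>(i, j)\<in>P. R_sub A B C D i (ev i j)))"
  have "finite P" using P by (rule finite_subset) simp
  have "card J = card (f ` J)" using inj by (simp add: card_image)
  also have "\<dots> = CARD('n)"
    using dim_span_eq_card_independent[OF ind] sp by simp
  finally have "CARD('n) = (\<Sum>k\<in>UNIV. \<nu> k)" by (simp add: J_def)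
  also have "\<dots> = \<nu> None + (\<Sum>i\<in>UNIV. \<nu> (Some i))"
    by (simp add: UNIV_option_conv sum.reindex)
  finally have n: "CARD('n) = \<nu> None + card ?J1" by simp
  have "\<exists>h. inj_on h {1..\<nu> (Some i)} \<and> h ` {1..\<nu> (Some i)} \<subseteq> {1..\<nu>bar i}
      \<and> (\<forall>j\<in>{1..\<nu> (Some i)}. ev i (h j) = \<mu> (Some i) j)" for i
    by (rule image_mset_subset_inj) (use le in auto)
  then obtain h where h: "\<And>i. inj_on (h i) {1..\<nu> (Some i)}"
      "\<And>i. h i ` {1..\<nu> (Some i)} \<subseteq> {1..\<nu>bar i}"
      "\<And>i j. j \<in> {1..\<nu> (Some i)} \<Longrightarrow> ev i (h i j) = \<mu> (Some i) j" by metis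
  define \<phi> where "\<phi> = (\<lambda>(i, j). (i, h i j))"
  have \<phi>: "inj_on \<phi> ?J1" "\<phi> ` ?J1 \<subseteq> ?I"
  proof -
    show "inj_on \<phi> ?J1" using h(1) by (auto simp: \<phi>_def inj_on_def)
    have "h i j \<in> {1..\<nu>bar i}" if "j \<in> {1..\<nu> (Some i)}" for i j using h(2) that by blast
    then show "\<phi> ` ?J1 \<subseteq> ?I" by (auto simp: \<phi>_def simp del: atLeastAtMost_iff)
  qed
  define K where "K = {x \<in> ?J1. \<phi> x \<in> P}"
  have "finite K" unfolding K_def by (rule finite_subset[of _ ?J1]) auto
  have "card P + card ?J1 \<le> card ?I + card K"
  proof -
    have "\<phi> ` K = P \<inter> \<phi> ` ?J1" by (auto simp: K_def)
    moreover have "card (\<phi> ` K) = card K"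
      by (rule card_image, rule inj_on_subset[OF \<phi>(1)]) (auto simp: K_def)
    ultimately have "card (P \<inter> \<phi> ` ?J1) = card K" by simp
    moreover have "card (\<phi> ` ?J1) = card ?J1" using \<phi>(1) by (rule card_image)
    moreover have "card (P \<union> \<phi> ` ?J1) \<le> card ?I"
      using P \<phi>(2) by (intro card_mono) auto
    moreover have "card P + card (\<phi> ` ?J1) = card (P \<union> \<phi> ` ?J1) + card (P \<inter> \<phi> ` ?J1)"
      using \<open>finite P\<close> by (intro card_Un_Int) auto
    ultimately show ?thesis by linarith
  qed
  moreover have "\<nu> None + card K \<le> dim ?W"
  proof -
    let ?K' = "Pair None ` {1..\<nu> None} \<union> (\<lambda>(i, j). (Some i, j)) ` K"
    have sub: "?K' \<subseteq> J" by (auto simp: J_def K_def)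
    have "card ((\<lambda>(i, j). (Some i, j)) ` K) = card K"
      by (rule card_image) (auto simp: inj_on_def)
    then have "card ?K' = \<nu> None + card K"
      using \<open>finite K\<close> by (subst card_Un_disjoint) (auto simp: card_image inj_on_def)
    moreover have "card (f ` ?K') = card ?K'"
      using inj_on_subset[OF inj sub] by (rule card_image)
    moreover have "independent (f ` ?K')"
      using ind sub by (meson image_mono independent_mono)
    moreover have "f ` ?K' \<subseteq> ?W"
    proof -
      have None_W: "v None j \<in> ?W" if "j \<in> {1..\<nu> None}" for j
      proof -
        let ?E = "v None ` {1..\<nu> None}"
        \<comment> \<open>The solving feedback \<open>F\<close> itself witnesses admissibility,
          since its restricted spectrum is part of the stable spectrum of the closed loop.\<close>
        have "stabilizability_output_nulling td A B C D (span ?E)"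
          unfolding stabilizability_output_nulling_def
        proof (intro conjI exI[of _ F] ballI)
          fix x assume x: "x \<in> span ?E"
          show "(A + B ** F) *v x \<in> span ?E" using x
          proof (induction rule: span_induct_alt)
            case (step c y z)
            then obtain j where j: "j \<in> {1..\<nu> None}" "y = v None j" by blast
            have "(A + B ** F) *v y \<in> span ?E"
              unfolding j(2) eig[OF j(1)] using j(1) by (intro span_scale span_base imageI)
            with step show ?case
              by (simp add: matrix_vector_right_distrib matrix_vector_mult_scaleR span_add span_scale)
          qed (simp add: span_zero)
          show "(C + D ** F) *v x = 0" using x
          proof (induction rule: span_induct_alt)
            case (step c y z)
            then have "(C + D ** F) *v y = 0" using null by auto
            with step show ?case
              by (simp add: matrix_vector_right_distrib matrix_vector_mult_scaleR)
          qed simp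
        qed (use spec in \<open>auto simp: spectrum_on_def matrix_spectrum_def\<close>)
        from stabilizability_output_nulling_le[OF ri ss real this]
        moreover have "v None j \<in> span ?E" using that by (intro span_base imageI)
        ultimately have "v None j \<in> ?S" by blast
        then show ?thesis by (simp add: span_base)
      qed
      have Some_W: "v (Some i) j \<in> ?W" if "(i, j) \<in> K" for i j
      proof -
        have j: "j \<in> {1..\<nu> (Some i)}" and P: "(i, h i j) \<in> P"
          using that by (auto simp: K_def \<phi>_def)
        have "v (Some i) j \<in> R_sub A B C D i (ev i (h i j))"
          unfolding R_sub_iff h(3)[OF j]
          using eig[OF j] out[OF j] by (auto simp: closed_loop_mult)
        then show ?thesis using P by (intro span_base UnI2) auto
      qed
      show ?thesis
      proof (rule image_subsetI)
        fix x assume "x \<in> ?K'"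
        then consider j where "j \<in> {1..\<nu> None}" "x = (None, j)"
          | i j where "(i, j) \<in> K" "x = (Some i, j)" by fast
        then show "f x \<in> ?W"
          by cases (simp_all only: f_def split_conv None_W Some_W)
      qed
    qed
    ultimately show ?thesis using independent_card_le_dim[of "f ` ?K'" ?W] by linarith
  qed
  ultimately have "card P + CARD('n) \<le> dim ?W + card ?I" using n by linarith
  then show ?thesis
    unfolding stable_zero_span_plus_R_sub[OF \<open>finite P\<close>] by simp
qed

lemma dim_ge_imp_solvable:
  fixes A :: "real^'n^'n" and B :: "real^'m^'n" and C :: "real^'n^'p" and D :: "real^'m^'p"
  assumes ri: "right_invertible A B C D"
    and dc: "dc_point td \<notin> invariant_zeros A B C D"
    and stable: "\<And>i j. j \<in> {1..\<nu>bar i} \<Longrightarrow> complex_of_real (ev i j) \<in> stable_region td"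
    and n: "CARD('n) = d + (\<Sum>i\<in>UNIV. \<nu>bar i)"
    and ge: "\<And>P. P \<subseteq> (SIGMA i:UNIV. {1..\<nu>bar i}) \<Longrightarrow>
      dim (stable_zero_span td A B C D + (\<Sum>(i, j)\<in>P. R_sub A B C D i (ev i j))) \<ge> card P + d"
  shows "problem_3B_solvable td A B C D \<nu>bar ev"
proof -
  let ?I = "SIGMA i:UNIV. {1..\<nu>bar i}"
  let ?S = "stable_zero_span td A B C D"
  let ?U = "\<lambda>(i, j). R_sub A B C D i (ev i j)"
  have finI: "finite ?I" by simp
  have "card P + d \<le> dim (?S \<union> \<Union> (?U ` P))" if "P \<subseteq> ?I" for P
    using ge[OF that] stable_zero_span_plus_R_sub[OF finite_subset[OF that finI], of td A B C D ev]
    by simp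
  from rado_deficiency[OF finI this] obtain Q v where Q: "Q \<subseteq> ?I"
    and vR: "\<And>x. x \<in> Q \<Longrightarrow> v x \<in> ?U x"
    and cardQ: "card ?I + d \<le> card Q + dim ?S" and dimQ: "dim (?S \<union> v ` Q) = dim ?S + card Q"
    by blast
  have finQ: "finite Q" using Q finI by (rule finite_subset)
  have "dim (?S \<union> v ` Q) \<le> CARD('n)" using dim_subset_UNIV_cart by blast
  \<comment> \<open>The deficiency bound gives at least \<open>CARD('n)\<close> and the ambient
    dimension at most that, so the selected vectors exactly complete a basis.\<close>
  then have total: "dim ?S + card Q = CARD('n)" using cardQ dimQ n by simp
  obtain E0 \<mu>0 w0 where E0: "independent E0" "span E0 = ?S"
    and st0: "\<And>b. b \<in> E0 \<Longrightarrow> complex_of_real (\<mu>0 b) \<in> stable_region td"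
    and eq0: "\<And>b. b \<in> E0 \<Longrightarrow> A *v b + B *v w0 b = \<mu>0 b *\<^sub>R b"
      "\<And>b. b \<in> E0 \<Longrightarrow> C *v b + D *v w0 b = 0"
    using stable_zero_span_basis[of td A B C D] by blast
  have fin0: "finite E0" using E0(1) by (rule independent_imp_finite)
  have card0: "card E0 = dim ?S" using dim_span_eq_card_independent[OF E0(1)] E0(2) by simp
  define E where "E = E0 \<union> v ` Q"
  have finE: "finite E" using fin0 finQ by (simp add: E_def)
  have "span (?S \<union> v ` Q) \<subseteq> span E"
    using E0(2) span_mono[of E0 E] span_superset[of E] by (intro span_minimal) (auto simp: E_def)
  then have "dim (?S \<union> v ` Q) \<le> dim E" by (metis dim_span dim_subset)
  then have dimE: "CARD('n) \<le> dim E" using dimQ total by simp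
  then have spE: "span E = UNIV"
    using dim_eq_full[of E] dim_subset_UNIV_cart[of E] by simp
  have cardE: "card E \<le> card E0 + card (v ` Q)" unfolding E_def by (rule card_Un_le)
  have cardvQ: "card (v ` Q) \<le> card Q" using finQ by (rule card_image_le)
  have "card E \<le> CARD('n)" using cardE cardvQ card0 total by simp
  \<comment> \<open>A spanning set with at most \<open>CARD('n)\<close> elements is a basis; the
    same count later excludes coincidences among the chosen vectors.\<close>
  then have indE: "independent E"
    using card_le_dim_spanning[of E UNIV] spE finE by simp
  have "card E = CARD('n)" using dim_span_eq_card_independent[OF indE] spE by simp
  then have "card (v ` Q) = card Q" "card E = card E0 + card (v ` Q)"
    using cardE cardvQ card0 total by simp_all
  then have injv: "inj_on v Q" and disj: "E0 \<inter> v ` Q = {}"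
    using finQ fin0 card_Un_Int[of E0 "v ` Q"] by (simp_all add: eq_card_imp_inj_on E_def)
  have "\<forall>x\<in>Q. \<exists>w \<beta>. A *v v x + B *v w = ev (fst x) (snd x) *\<^sub>R v x \<and>
      C *v v x + D *v w = \<beta> *\<^sub>R axis (fst x) 1"
    using vR R_sub_iff by (fastforce simp: split_beta)
  then obtain wQ \<beta> where
    eqQ: "\<And>x. x \<in> Q \<Longrightarrow> A *v v x + B *v wQ x = ev (fst x) (snd x) *\<^sub>R v x"
      "\<And>x. x \<in> Q \<Longrightarrow> C *v v x + D *v wQ x = \<beta> x *\<^sub>R axis (fst x) 1" by metis
  have stQ: "complex_of_real (ev (fst x) (snd x)) \<in> stable_region td" if "x \<in> Q" for x
    using that Q by (intro stable) auto
  have \<beta>: "\<beta> x \<noteq> 0" if x: "x \<in> Q" for x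
  proof
    assume "\<beta> x = 0"
    then have "v x \<in> zero_directions A B C D (ev (fst x) (snd x))"
      using eqQ[OF x] by (auto simp: zero_directions_def)
    then have "v x \<in> span E0"
      using zero_directions_stable_zero_span[OF stQ[OF x]] E0(2) by blast
    moreover have "E0 \<subseteq> E - {v x}" using disj x by (auto simp: E_def)
    ultimately have "v x \<in> span (E - {v x})" using span_mono by blast
    then show False using indE x unfolding dependent_def E_def by blast
  qed
  define w where "w b = (if b \<in> E0 then w0 b else wQ (inv_into Q v b))" for b
  define \<mu>E where "\<mu>E b = (if b \<in> E0 then \<mu>0 b else (\<lambda>x. ev (fst x) (snd x)) (inv_into Q v b))" for b
  have on0: "w b = w0 b" "\<mu>E b = \<mu>0 b" if "b \<in> E0" for b using that by (simp_all add: w_def \<mu>E_def)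
  have onQ: "w (v x) = wQ x" "\<mu>E (v x) = ev (fst x) (snd x)" if "x \<in> Q" for x
    using that disj injv by (auto simp: w_def \<mu>E_def)
  obtain F :: "real^'n^'m" where F: "\<And>b. b \<in> E \<Longrightarrow> F *v b = w b"
    using feedback_exists[OF indE, of w] by blast
  have eig: "(A + B ** F) *v b = \<mu>E b *\<^sub>R b" if "b \<in> E" for b
    using that F[OF that] eq0(1) eqQ(1) on0 onQ by (auto simp: E_def closed_loop_mult)
  have null: "(C + D ** F) *v b = 0" if "b \<in> E0" for b
    using that F[of b] eq0(2) on0 by (simp add: E_def closed_loop_mult)
  have out: "(C + D ** F) *v v x = \<beta> x *\<^sub>R axis (fst x) 1" if "x \<in> Q" for x
    using that F[of "v x"] eqQ(2) onQ by (simp add: E_def closed_loop_mult)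
  have stE: "complex_of_real (\<mu>E b) \<in> stable_region td" if "b \<in> E" for b
    using that st0 stQ on0 onQ by (auto simp: E_def)
  have spec: "matrix_spectrum (A + B ** F) \<subseteq> stable_region td"
    unfolding matrix_spectrum_def using eigenbasis_spectrum[OF indE eig] spE stE by blast
  obtain G :: "real^'p^'m" where G: "static_gain td A B C D F ** G = mat 1"
    using static_gain_right_inverse[OF ri dc spec] .
  have track: "tracks_constants td A B C D F G"
    by (rule eigenbasis_tracking[OF indE spE eig stE dc_resolvent_invertible[OF spec] G])
  \<comment> \<open>The selected indices of an output may have gaps, whereas modes are numbered
    consecutively from 1; the bijections \<open>h i\<close> renumber them.\<close>
  define Qi where "Qi i = {j. (i, j) \<in> Q}" for i
  have Qi: "Qi i \<subseteq> {1..\<nu>bar i}" "finite (Qi i)" for i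
    using Q finite_subset[of "Qi i" "{1..\<nu>bar i}"] by (auto simp: Qi_def)
  have "\<exists>h. bij_betw h {1..card (Qi i)} (Qi i)" for i
    using ex_bij_betw_nat_finite_1[OF Qi(2)] .
  then obtain h where h: "\<And>i. bij_betw (h i) {1..card (Qi i)} (Qi i)" by metis
  obtain e0 where e0: "bij_betw e0 {1..card E0} E0"
    using ex_bij_betw_nat_finite_1[OF fin0] by blast
  define \<nu> where "\<nu> k = (case k of None \<Rightarrow> card E0 | Some i \<Rightarrow> card (Qi i))" for k
  define \<mu> where "\<mu> k j = (case k of None \<Rightarrow> \<mu>0 (e0 j) | Some i \<Rightarrow> ev i (h i j))" for k j
  define u where "u k j = (case k of None \<Rightarrow> e0 j | Some i \<Rightarrow> v (i, h i j))" for k j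
  let ?J = "SIGMA k:UNIV. {1..\<nu> k}"
  let ?f = "\<lambda>(k, j). u k j"
  have hQ: "(i, h i j) \<in> Q" if "j \<in> {1..card (Qi i)}" for i j
    using bij_betwE[OF h[of i]] that by (auto simp: Qi_def)
  have e0E: "e0 j \<in> E0" if "j \<in> {1..card E0}" for j using bij_betwE[OF e0] that by blast
  have img: "?f ` ?J = E"
  proof
    show "?f ` ?J \<subseteq> E"
      using hQ e0E by (auto simp: \<nu>_def u_def E_def split: option.splits)
    show "E \<subseteq> ?f ` ?J"
    proof
      fix b assume "b \<in> E"
      then consider "b \<in> E0" | i j where "(i, j) \<in> Q" "b = v (i, j)" by (auto simp: E_def)
      then show "b \<in> ?f ` ?J"
      proof cases
        case 1
        then obtain j where "j \<in> {1..card E0}" "b = e0 j"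
          using e0 by (metis bij_betw_imp_surj_on imageE)
        then show ?thesis by (intro image_eqI[of _ _ "(None, j)"]) (simp_all add: \<nu>_def u_def)
      next
        case 2
        then have "j \<in> Qi i" by (simp add: Qi_def)
        then obtain l where "l \<in> {1..card (Qi i)}" "j = h i l"
          using h by (metis bij_betw_imp_surj_on imageE)
        then show ?thesis using 2 by (intro image_eqI[of _ _ "(Some i, l)"]) (simp_all add: \<nu>_def u_def)
      qed
    qed
  qed
  \<comment> \<open>The image is the basis \<open>E\<close>, and the index set has just as many
    elements.\<close>
  have inj: "inj_on ?f ?J"
  proof (rule eq_card_imp_inj_on)
    show "finite ?J" by simp
    have "card ?J = (\<Sum>k\<in>UNIV. \<nu> k)" by simp
    also have "\<dots> = card E0 + (\<Sum>i\<in>UNIV. card (Qi i))"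
      by (simp add: UNIV_option_conv sum.reindex \<nu>_def)
    also have "(\<Sum>i\<in>UNIV. card (Qi i)) = card (SIGMA i:UNIV. Qi i)" using Qi(2) by simp
    also have "(SIGMA i:UNIV. Qi i) = Q" by (auto simp: Qi_def)
    finally show "card (?f ` ?J) = card ?J"
      unfolding img using \<open>card E = CARD('n)\<close> card0 total by simp
  qed
  have "state_to_output_decoupling A B C D F \<nu> \<mu> u"
    unfolding state_to_output_decoupling_def Let_def img
  proof (intro conjI inj indE spE)
    show "\<forall>(k, j)\<in>?J. (A + B ** F) *v u k j = \<mu> k j *\<^sub>R u k j"
    proof (safe, goal_cases)
      case (1 k j)
      show ?case
      proof (cases k)
        case None
        then have "e0 j \<in> E0" using 1 e0E by (simp add: \<nu>_def)
        then show ?thesis using None eig on0 by (simp add: E_def u_def \<mu>_def)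
      next
        case (Some i)
        then have "(i, h i j) \<in> Q" using 1 hQ by (simp add: \<nu>_def)
        then show ?thesis using Some eig[of "v (i, h i j)"] onQ by (simp add: E_def u_def \<mu>_def)
      qed
    qed
    show "\<forall>j\<in>{1..\<nu> None}. (C + D ** F) *v u None j = 0"
      using null e0E by (simp add: \<nu>_def u_def)
    show "\<forall>i. \<forall>j\<in>{1..\<nu> (Some i)}. \<exists>\<beta>. \<beta> \<noteq> 0 \<and> (C + D ** F) *v u (Some i) j = \<beta> *\<^sub>R axis i 1"
    proof (intro allI ballI)
      fix i j assume "j \<in> {1..\<nu> (Some i)}"
      then have "(i, h i j) \<in> Q" using hQ by (simp add: \<nu>_def)
      from \<beta>[OF this] out[OF this]
      show "\<exists>\<beta>. \<beta> \<noteq> 0 \<and> (C + D ** F) *v u (Some i) j = \<beta> *\<^sub>R axis i 1"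
        by (auto simp: u_def)
    qed
  qed
  moreover have "\<nu> (Some i) \<le> \<nu>bar i" for i
    using card_mono[OF _ Qi(1)[of i]] by (simp add: \<nu>_def)
  moreover have "image_mset (\<mu> (Some i)) (mset_set {1..\<nu> (Some i)})
      \<subseteq># image_mset (ev i) (mset_set {1..\<nu>bar i})" for i
  proof -
    have "image_mset (\<mu> (Some i)) (mset_set {1..\<nu> (Some i)})
        = image_mset (ev i) (image_mset (h i) (mset_set {1..card (Qi i)}))"
      by (simp add: \<mu>_def[abs_def] \<nu>_def image_mset.compositionality o_def)
    also have "image_mset (h i) (mset_set {1..card (Qi i)}) = mset_set (Qi i)"
      using h[of i] by (simp add: bij_betw_def image_mset_mset_set)
    also have "image_mset (ev i) (mset_set (Qi i)) \<subseteq># image_mset (ev i) (mset_set {1..\<nu>bar i})"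
      using Qi(1) by (intro image_mset_subseteq_mono subset_imp_msubset_mset_set) auto
    finally show ?thesis .
  qed
  ultimately show ?thesis
    unfolding problem_3B_solvable_def using spec G track by blast
qed

theorem theorem18:
  fixes td :: time_domain
    and A :: "real^'n^'n" and B :: "real^'m^'n" and C :: "real^'n^'p" and D :: "real^'m^'p"
    and \<nu>bar :: "'p \<Rightarrow> nat" and \<nu>bar0 :: nat
    and ev :: "'p \<Rightarrow> nat \<Rightarrow> real"
    and I :: "('p \<times> nat) set"
  assumes right_inv: "right_invertible A B C D"
    and stabilizable: "stabilizable td A B"
    and no_dc_zero: "dc_point td \<notin> invariant_zeros A B C D"
    and semisimple: "\<And>z. z \<in> minimum_phase_zeros td A B C D \<Longrightarrow>
          algebraic_multiplicity A B C D z = geometric_multiplicity A B C D z"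
    and real_zeros: "minimum_phase_zeros td A B C D \<subseteq> \<real>"
    and sum_le: "(\<Sum>i\<in>UNIV. \<nu>bar i) \<le> CARD('n)"
    and \<nu>bar0: "\<nu>bar0 = CARD('n) - (\<Sum>i\<in>UNIV. \<nu>bar i)"
    and assigned: "\<And>i j. j \<in> {1..\<nu>bar i} \<Longrightarrow> complex_of_real (ev i j) \<in> stable_region td"
    and I: "I = (SIGMA i:UNIV. {1..\<nu>bar i})"
  shows "problem_3B_solvable td A B C D \<nu>bar ev \<longleftrightarrow>
    (\<forall>P\<in>Pow I.
       dim (Vg_star td A B C D + (\<Sum>(i, j)\<in>P. R_sub A B C D i (ev i j))) \<ge> card P + \<nu>bar0)"
proof -
  \<comment> \<open>\<open>sum_le\<close> makes the natural subtraction in \<open>\<nu>bar0\<close>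
    exact.\<close>
  have n: "CARD('n) = \<nu>bar0 + (\<Sum>i\<in>UNIV. \<nu>bar i)" using sum_le \<nu>bar0 by simp
  have Vg: "Vg_star td A B C D = stable_zero_span td A B C D"
    using semisimple by (intro Vg_star_eq right_inv real_zeros)
  show ?thesis
    unfolding Vg
  proof
    assume "problem_3B_solvable td A B C D \<nu>bar ev"
    then have "card P + CARD('n) \<le> dim (stable_zero_span td A B C D
        + (\<Sum>(i, j)\<in>P. R_sub A B C D i (ev i j))) + (\<Sum>i\<in>UNIV. \<nu>bar i)" if "P \<subseteq> I" for P
      using semisimple that unfolding I by (intro solvable_imp_dim_ge right_inv real_zeros)
    then show "\<forall>P\<in>Pow I. dim (stable_zero_span td A B C D
        + (\<Sum>(i, j)\<in>P. R_sub A B C D i (ev i j))) \<ge> card P + \<nu>bar0"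
      using n by fastforce
  next
    assume "\<forall>P\<in>Pow I. dim (stable_zero_span td A B C D
        + (\<Sum>(i, j)\<in>P. R_sub A B C D i (ev i j))) \<ge> card P + \<nu>bar0"
    then show "problem_3B_solvable td A B C D \<nu>bar ev"
      using assigned n unfolding I
      by (intro dim_ge_imp_solvable[where d = \<nu>bar0] right_inv no_dc_zero) auto
  qed
qed

end
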